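(* Let $(\mathfrak{g},[\cdot,\cdot]_\alpha,\alpha)$ be a simple multiplicative Hom-Lie algebra and let $\mathfrak{g}=\mathfrak{g}_1\oplus\alpha(\mathfrak{g}_1)\oplus\cdots\oplus\alpha^{n-1}(\mathfrak{g}_1)$ be its induced Lie algebra, with $\mathfrak{g}_1$ a simple ideal of it and $\alpha^n(\mathfrak{g}_1)=\mathfrak{g}_1$. Let $\mathfrak{h}_1$ be a Cartan subalgebra of $\mathfrak{g}_1$. (1) Consider $n$ weight modules $(V_0,\rho_0),(V_1,\rho_1),\ldots,(V_{n-1},\rho_{n-1})$ of $\mathfrak{g}_1$. Then for every integer $k=0,\ldots,n-1$ there exist a representation $(V_k,\widetilde{\rho}_k)$ of $\alpha^k(\mathfrak{g}_1)$ on $V_k$ and $\beta_k\in GL(V_k)$ satisfying $\widetilde{\rho}_k(\alpha^k(x))=\beta_k^k\circ\rho_k(x)\circ\beta_k^{-k}$ for all $x\in\mathfrak{g}_1$. Then $V_k$ is a weight module of $\alpha^k(\mathfrak{g}_1)$, and $\beta_k^k((V_k)_\lambda)$ is a weight subspace of $V_k$ of weight $\lambda\circ\alpha^{-k}$. (2) Let $P(V_i)$ be the set of weights of $V_i$ with respect to $\mathfrak{h}_1$. The set of weights of $V=\bigotimes_{i=0}^{n-1}V_i$ with respect to $\mathfrak{h}=\mathfrak{h}_1\oplus\alpha(\mathfrak{h}_1)\oplus\cdots\oplus\alpha^{n-1}(\mathfrak{h}_1)$ is $$P_{\mathfrak{h}}(V)=\Big\{\sum_{k=0}^{n-1}\lambda_k\circ\alpha^{-k}\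 :\ \lambda_k\in P(V_k)\Big\},$$ and the weight decomposition of $V$ is $$V=\bigoplus_{\lambda\in P_{\mathfrak{h}}(V)}\Big((V_0)_{\lambda_0}\otimes(V_1)_{\lambda_1\circ\alpha^{-1}}\otimes\cdots\otimes(V_{n-1})_{\lambda_{n-1}\circ\alpha^{1-n}}\Big),$$ where $\lambda=\sum_{k=0}^{n-1}\lambda_k\circ\alpha^{-k}$.
   Context: The base field $\mathbb{K}$ is algebraically closed of characteristic $0$. A Hom-Lie algebra is a triple $(\mathfrak{g},[\cdot,\cdot]_\alpha,\alpha)$ with $[\cdot,\cdot]_\alpha$ a skewsymmetric bilinear map and $\alpha:\mathfrak{g}\to\mathfrak{g}$ linear such that the cyclic sum over $x,y,z$ of $[\alpha(x),[y,z]_\alpha]_\alpha$ is $0$. It is multiplicative if $\alpha([x,y]_\alpha)=[\alpha(x),\alpha(y)]_\alpha$. An ideal is a subspace $\mathfrak{k}$ with $\alpha(\mathfrak{k})\subseteq\mathfrak{k}$ and $[\mathfrak{k},\mathfrak{g}]_\alpha\subseteq\mathfrak{k}$. It is simple if it has no proper ideals (other than $0$ and $\mathfrak{g}$) and $[\mathfrak{g},\mathfrak{g}]_\alpha=\mathfrak{g}$. For a simple multiplicative Hom-Lie algebra, $\alpha$ is bijective, and the induced Lie algebra is $\mathfrak{g}$ with bracket $[x,y]=\alpha^{-1}([x,y]_\alpha)$; it is semisimple and $\alpha$ is an automorphism of it. For a (semi)simple Lie algebra with Cartan subalgebra $\mathfrak{h}$ and a representation $(V,\rho)$, put $V_\lambda=\{v\in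 V:\rho(h)v=\lambda(h)v\ \forall h\in\mathfrak{h}\}$ for $\lambda\in\mathfrak{h}^*$; if $V_\lambda\ne 0$, $\lambda$ is a weight and $V_\lambda$ a weight subspace; $P(V)$ is the set of weights; $V$ is a weight module if $V=\bigoplus_{\lambda\in P(V)}V_\lambda$. For $\lambda\in P(V_k)$, $\lambda\circ\alpha^{-k}$ is a linear form on $\alpha^k(\mathfrak{h}_1)$, viewed on $\mathfrak{h}$ by extension by zero on the other summands, and $(V_k)_{\lambda\circ\alpha^{-k}}$ is the weight subspace of the $\alpha^k(\mathfrak{g}_1)$-module $(V_k,\widetilde\rho_k)$ with respect to the Cartan subalgebra $\alpha^k(\mathfrak{h}_1)$. $V=\bigotimes V_i$ is the $\mathfrak{g}$-module on which $(y_0,\ldots,y_{n-1})$ with $y_k\in\alpha^k(\mathfrak{g}_1)$ acts by $\sum_k Id\otimes\cdots\otimes\widetilde\rho_k(y_k)\otimes\cdots\otimes Id$. *)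

theory Defs
  imports
    "HOL-Computational_Algebra.Polynomial"
    "HOL-Library.FuncSet"
    "HOL-Library.Function_Algebras"
begin

section \<open>Linear algebra relative to subspaces\<close>

text \<open>
  A vector space is a type with a scalar multiplication satisfying \<open>vector_space\<close>; the
  subspaces occurring below (ideals, Cartan subalgebras, modules) are sets of type \<open>'a set\<close>.
  In particular several modules of different dimensions are given as subspaces of one
  ambient space of arbitrary dimension.
\<close>

definition linear_on ::
  "('k \<Rightarrow> 'a \<Rightarrow> 'a) \<Rightarrow> ('k \<Rightarrow> 'b \<Rightarrow> 'b) \<Rightarrow> 'a::ab_group_add set \<Rightarrow> 'b::ab_group_add set
    \<Rightarrow> ('a \<Rightarrow> 'b) \<Rightarrow> bool" where
  "linear_on sa sb S T f \<longleftrightarrow>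
     f \<in> S \<rightarrow> T \<and>
     (\<forall>x\<in>S. \<forall>y\<in>S. f (x + y) = f x + f y) \<and>
     (\<forall>c. \<forall>x\<in>S. f (sa c x) = sb c (f x))"

definition GL_on :: "('k \<Rightarrow> 'a \<Rightarrow> 'a) \<Rightarrow> 'a::ab_group_add set \<Rightarrow> ('a \<Rightarrow> 'a) set" where
  "GL_on s V = {\<beta>. linear_on s s V V \<beta> \<and> bij_betw \<beta> V V}"

text \<open>A linear form on \<open>S\<close> is normalised to be \<^term>\<open>undefined\<close> outside \<open>S\<close>, so that equality of
  forms is equality of functions.\<close>

definition dual_on :: "('k::field \<Rightarrow> 'a \<Rightarrow> 'a) \<Rightarrow> 'a::ab_group_add set \<Rightarrow> ('a \<Rightarrow> 'k) set" where
  "dual_on s S = {\<mu> \<in> extensional S. linear_on s (*) S UNIV \<mu>}"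

definition internal_direct_sum ::
  "('k::field \<Rightarrow> 'a \<Rightarrow> 'a) \<Rightarrow> 'a::ab_group_add set \<Rightarrow> 'i set \<Rightarrow> ('i \<Rightarrow> 'a set) \<Rightarrow> bool" where
  "internal_direct_sum s V I U \<longleftrightarrow>
     (\<forall>i\<in>I. module.subspace s (U i)) \<and>
     V = module.span s (\<Union>i\<in>I. U i) \<and>
     (\<forall>J u. finite J \<and> J \<subseteq> I \<and> (\<forall>j\<in>J. u j \<in> U j) \<and> (\<Sum>j\<in>J. u j) = 0
        \<longrightarrow> (\<forall>j\<in>J. u j = 0))"

definition sum_of :: "nat \<Rightarrow> (nat \<Rightarrow> 'a::ab_group_add set) \<Rightarrow> 'a set" where
  "sum_of n S = (\<lambda>y. \<Sum>k<n. y k) ` (\<Pi>\<^sub>E k\<in>{..<n}. S k)"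

text \<open>The \<open>k\<close>-th component \<open>y\<^sub>k\<close> of \<open>x = (y\<^sub>0, \<dots>, y\<^sub>n\<^sub>-\<^sub>1)\<close>; meaningful when the sum of the
  \<open>S k\<close> is direct and contains \<open>x\<close>.\<close>

definition component :: "nat \<Rightarrow> (nat \<Rightarrow> 'a::ab_group_add set) \<Rightarrow> 'a \<Rightarrow> nat \<Rightarrow> 'a" where
  "component n S x = (THE y. y \<in> (\<Pi>\<^sub>E k\<in>{..<n}. S k) \<and> (\<Sum>k<n. y k) = x)"


section \<open>Hom-Lie algebras\<close>

locale hom_lie_algebra = vector_space scale
  for scale :: "'k::field \<Rightarrow> 'g::ab_group_add \<Rightarrow> 'g" +
  fixes brk :: "'g \<Rightarrow> 'g \<Rightarrow> 'g" and \<alpha> :: "'g \<Rightarrow> 'g"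
  assumes linear_left: "Vector_Spaces.linear scale scale (\<lambda>x. brk x y)"
    and linear_right: "Vector_Spaces.linear scale scale (\<lambda>y. brk x y)"
    and skew: "brk x y = - brk y x"
    and linear_twist: "Vector_Spaces.linear scale scale \<alpha>"
    and hom_jacobi: "brk (\<alpha> x) (brk y z) + brk (\<alpha> y) (brk z x) + brk (\<alpha> z) (brk x y) = 0"
begin

definition hom_ideal :: "'g set \<Rightarrow> bool" where
  "hom_ideal I \<longleftrightarrow> subspace I \<and> \<alpha> ` I \<subseteq> I \<and> (\<forall>x\<in>I. \<forall>y. brk x y \<in> I)"

end

locale multiplicative_hom_lie_algebra = hom_lie_algebra +
  assumes multiplicative: "\<alpha> (brk x y) = brk (\<alpha> x) (\<alpha> y)"

locale simple_multiplicative_hom_lie_algebra = multiplicative_hom_lie_algebra +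
  assumes no_proper_ideals: "hom_ideal I \<Longrightarrow> I = {0} \<or> I = UNIV"
    and perfect: "span {brk x y | x y. True} = UNIV"

definition induced_bracket :: "('g \<Rightarrow> 'g \<Rightarrow> 'g) \<Rightarrow> ('g \<Rightarrow> 'g) \<Rightarrow> 'g \<Rightarrow> 'g \<Rightarrow> 'g" where
  "induced_bracket brk \<alpha> x y = inv \<alpha> (brk x y)"


section \<open>Subalgebras of a Lie algebra with bracket \<open>br\<close>\<close>

definition lie_ideal ::
  "('k::field \<Rightarrow> 'g \<Rightarrow> 'g) \<Rightarrow> ('g \<Rightarrow> 'g \<Rightarrow> 'g) \<Rightarrow> 'g::ab_group_add set \<Rightarrow> 'g set \<Rightarrow> bool" where
  "lie_ideal s br L I \<longleftrightarrow>
     module.subspace s I \<and> I \<subseteq> L \<and> (\<forall>x\<in>I. \<forall>y\<in>L. br x y \<in> I)"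

definition simple_lie ::
  "('k::field \<Rightarrow> 'g \<Rightarrow> 'g) \<Rightarrow> ('g \<Rightarrow> 'g \<Rightarrow> 'g) \<Rightarrow> 'g::ab_group_add set \<Rightarrow> bool" where
  "simple_lie s br L \<longleftrightarrow>
     (\<exists>x\<in>L. \<exists>y\<in>L. br x y \<noteq> 0) \<and> (\<forall>I. lie_ideal s br L I \<longrightarrow> I = {0} \<or> I = L)"

primrec lower_central ::
  "('k::field \<Rightarrow> 'g \<Rightarrow> 'g) \<Rightarrow> ('g \<Rightarrow> 'g \<Rightarrow> 'g) \<Rightarrow> 'g::ab_group_add set \<Rightarrow> nat \<Rightarrow> 'g set" where
  "lower_central s br H 0 = H"
| "lower_central s br H (Suc m) =
     module.span s {br x y | x y. x \<in> H \<and> y \<in> lower_central s br H m}"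

definition cartan_subalgebra ::
  "('k::field \<Rightarrow> 'g \<Rightarrow> 'g) \<Rightarrow> ('g \<Rightarrow> 'g \<Rightarrow> 'g) \<Rightarrow> 'g::ab_group_add set \<Rightarrow> 'g set \<Rightarrow> bool" where
  "cartan_subalgebra s br L H \<longleftrightarrow>
     module.subspace s H \<and> H \<subseteq> L \<and> (\<forall>x\<in>H. \<forall>y\<in>H. br x y \<in> H) \<and>
     (\<exists>m. lower_central s br H m = {0}) \<and>
     {x \<in> L. \<forall>y\<in>H. br x y \<in> H} = H"


section \<open>Representations and weights\<close>

definition lie_rep ::
  "('k::field \<Rightarrow> 'g \<Rightarrow> 'g) \<Rightarrow> ('g \<Rightarrow> 'g \<Rightarrow> 'g) \<Rightarrow> 'g::ab_group_add set
    \<Rightarrow> ('k \<Rightarrow> 'v \<Rightarrow> 'v) \<Rightarrow> 'v::ab_group_add set \<Rightarrow> ('g \<Rightarrow> 'v \<Rightarrow> 'v) \<Rightarrow> bool" where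
  "lie_rep s br L sv V \<rho> \<longleftrightarrow>
     module.subspace sv V \<and>
     (\<forall>x\<in>L. linear_on sv sv V V (\<rho> x)) \<and>
     (\<forall>v\<in>V. linear_on s sv L V (\<lambda>x. \<rho> x v)) \<and>
     (\<forall>x\<in>L. \<forall>y\<in>L. \<forall>v\<in>V. \<rho> (br x y) v = \<rho> x (\<rho> y v) - \<rho> y (\<rho> x v))"

definition weight_space ::
  "('k \<Rightarrow> 'v \<Rightarrow> 'v) \<Rightarrow> 'g set \<Rightarrow> 'v set \<Rightarrow> ('g \<Rightarrow> 'v \<Rightarrow> 'v) \<Rightarrow> ('g \<Rightarrow> 'k) \<Rightarrow> 'v set" where
  "weight_space sv H V \<rho> \<mu> = {v \<in> V. \<forall>h\<in>H. \<rho> h v = sv (\<mu> h) v}"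

definition weights ::
  "('k::field \<Rightarrow> 'g \<Rightarrow> 'g) \<Rightarrow> ('k \<Rightarrow> 'v \<Rightarrow> 'v) \<Rightarrow> 'g::ab_group_add set \<Rightarrow> 'v::ab_group_add set
    \<Rightarrow> ('g \<Rightarrow> 'v \<Rightarrow> 'v) \<Rightarrow> ('g \<Rightarrow> 'k) set" where
  "weights s sv H V \<rho> = {\<mu> \<in> dual_on s H. weight_space sv H V \<rho> \<mu> \<noteq> {0}}"

definition weight_module ::
  "('k::field \<Rightarrow> 'g \<Rightarrow> 'g) \<Rightarrow> ('g \<Rightarrow> 'g \<Rightarrow> 'g) \<Rightarrow> 'g::ab_group_add set \<Rightarrow> 'g set
    \<Rightarrow> ('k \<Rightarrow> 'v \<Rightarrow> 'v) \<Rightarrow> 'v::ab_group_add set \<Rightarrow> ('g \<Rightarrow> 'v \<Rightarrow> 'v) \<Rightarrow> bool" where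
  "weight_module s br L H sv V \<rho> \<longleftrightarrow>
     lie_rep s br L sv V \<rho> \<and>
     internal_direct_sum sv V (weights s sv H V \<rho>) (weight_space sv H V \<rho>)"


section \<open>Twisting by powers of \<open>\<alpha>\<close> and \<open>\<beta>\<close>\<close>

text \<open>\<open>\<rho>' (\<alpha>\<^sup>k x) = \<beta>\<^sup>k \<circ> \<rho> x \<circ> \<beta>\<^sup>-\<^sup>k\<close> on \<open>V\<close>, for all \<open>x\<close> in \<open>L\<close>.\<close>

definition twist_compatible ::
  "('g \<Rightarrow> 'g) \<Rightarrow> nat \<Rightarrow> 'g set \<Rightarrow> 'v set \<Rightarrow> ('g \<Rightarrow> 'v \<Rightarrow> 'v) \<Rightarrow> ('g \<Rightarrow> 'v \<Rightarrow> 'v)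
    \<Rightarrow> ('v \<Rightarrow> 'v) \<Rightarrow> bool" where
  "twist_compatible \<alpha> k L V \<rho> \<rho>' \<beta> \<longleftrightarrow>
     (\<forall>x\<in>L. \<forall>v\<in>V. \<rho>' ((\<alpha> ^^ k) x) v = (\<beta> ^^ k) (\<rho> x ((inv_into V \<beta> ^^ k) v)))"

text \<open>The linear form \<open>\<mu> \<circ> \<alpha>\<^sup>-\<^sup>k\<close> on \<open>\<alpha>\<^sup>k(H)\<close>.\<close>

definition twisted_form :: "('g \<Rightarrow> 'g) \<Rightarrow> 'g set \<Rightarrow> nat \<Rightarrow> ('g \<Rightarrow> 'k) \<Rightarrow> 'g \<Rightarrow> 'k" where
  "twisted_form \<alpha> H k \<mu> = restrict (\<lambda>x. \<mu> ((inv \<alpha> ^^ k) x)) ((\<alpha> ^^ k) ` H)"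

text \<open>A form on the summand \<open>S k\<close>, extended by zero on the other summands.\<close>

definition extend_form ::
  "nat \<Rightarrow> (nat \<Rightarrow> 'g::ab_group_add set) \<Rightarrow> nat \<Rightarrow> ('g \<Rightarrow> 'k) \<Rightarrow> 'g \<Rightarrow> 'k" where
  "extend_form n S k \<nu> = restrict (\<lambda>x. \<nu> (component n S x k)) (sum_of n S)"

text \<open>The form \<open>\<Sum>\<^sub>k \<mu>\<^sub>k \<circ> \<alpha>\<^sup>-\<^sup>k\<close> on \<open>H \<oplus> \<alpha>(H) \<oplus> \<dots> \<oplus> \<alpha>\<^sup>n\<^sup>-\<^sup>1(H)\<close>.\<close>

definition total_form ::
  "('g \<Rightarrow> 'g) \<Rightarrow> 'g::ab_group_add set \<Rightarrow> nat \<Rightarrow> (nat \<Rightarrow> 'g \<Rightarrow> 'k::comm_monoid_add) \<Rightarrow> 'g \<Rightarrow> 'k" where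
  "total_form \<alpha> H n \<mu> =
     restrict (\<lambda>x. \<Sum>k<n. extend_form n (\<lambda>j. (\<alpha> ^^ j) ` H) k (twisted_form \<alpha> H k (\<mu> k)) x)
       (sum_of n (\<lambda>j. (\<alpha> ^^ j) ` H))"


section \<open>Tensor products of finite families of vector spaces\<close>

text \<open>
  The tensor product of \<open>V 0, \<dots>, V (n - 1)\<close> is built inside the dual of the space of
  multilinear forms: \<open>v\<^sub>0 \<otimes> \<dots> \<otimes> v\<^sub>n\<^sub>-\<^sub>1\<close> is evaluation at \<open>(v\<^sub>0, \<dots>, v\<^sub>n\<^sub>-\<^sub>1)\<close>, and the tensor
  product is the span of these evaluations.  The lemmas \<open>multilinear_pure_tensor\<close> and
  \<open>tensor_space_universal\<close> below show that this has the universal property of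
  the tensor product, without any assumption on the dimensions.
\<close>

definition multilinear_on ::
  "('k \<Rightarrow> 'v \<Rightarrow> 'v) \<Rightarrow> ('k \<Rightarrow> 'w \<Rightarrow> 'w) \<Rightarrow> nat \<Rightarrow> (nat \<Rightarrow> 'v::ab_group_add set)
    \<Rightarrow> ((nat \<Rightarrow> 'v) \<Rightarrow> 'w::ab_group_add) \<Rightarrow> bool" where
  "multilinear_on sv sw n V f \<longleftrightarrow>
     (\<forall>v \<in> (\<Pi>\<^sub>E k\<in>{..<n}. V k). \<forall>k<n. linear_on sv sw (V k) UNIV (\<lambda>a. f (v(k := a))))"

definition fun_scale :: "'k::field \<Rightarrow> ('a \<Rightarrow> 'k) \<Rightarrow> 'a \<Rightarrow> 'k" where
  "fun_scale c F = (\<lambda>\<phi>. c * F \<phi>)"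

type_synonym ('v, 'k) tensor = "((nat \<Rightarrow> 'v) \<Rightarrow> 'k) \<Rightarrow> 'k"

definition pure_tensor ::
  "('k::field \<Rightarrow> 'v \<Rightarrow> 'v) \<Rightarrow> nat \<Rightarrow> (nat \<Rightarrow> 'v::ab_group_add set)
    \<Rightarrow> (nat \<Rightarrow> 'v) \<Rightarrow> ('v, 'k) tensor" where
  "pure_tensor sv n V v = (\<lambda>\<phi>. if multilinear_on sv (*) n V \<phi> then \<phi> v else 0)"

text \<open>For subspaces \<open>U k\<close> of \<open>V k\<close>: the subspace \<open>U 0 \<otimes> \<dots> \<otimes> U (n - 1)\<close> of the tensor product of
  the \<open>V k\<close>.\<close>

definition tensor_subspace ::
  "('k::field \<Rightarrow> 'v \<Rightarrow> 'v) \<Rightarrow> nat \<Rightarrow> (nat \<Rightarrow> 'v::ab_group_add set) \<Rightarrow> (nat \<Rightarrow> 'v set)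
    \<Rightarrow> ('v, 'k) tensor set" where
  "tensor_subspace sv n V U =
     module.span fun_scale (pure_tensor sv n V ` (\<Pi>\<^sub>E k\<in>{..<n}. U k))"

definition tensor_space ::
  "('k::field \<Rightarrow> 'v \<Rightarrow> 'v) \<Rightarrow> nat \<Rightarrow> (nat \<Rightarrow> 'v::ab_group_add set) \<Rightarrow> ('v, 'k) tensor set" where
  "tensor_space sv n V = tensor_subspace sv n V V"

text \<open>The operator \<open>Id \<otimes> \<dots> \<otimes> f \<otimes> \<dots> \<otimes> Id\<close> with \<open>f\<close> in position \<open>k\<close>, as the transpose of the
  substitution of \<open>f\<close> into the \<open>k\<close>-th argument of a form; its value on pure tensors is
  given by \<open>tensor_slot_pure_tensor\<close> below.\<close>

definition tensor_slot ::
  "('k::field \<Rightarrow> 'v \<Rightarrow> 'v) \<Rightarrow> nat \<Rightarrow> (nat \<Rightarrow> 'v::ab_group_add set) \<Rightarrow> nat \<Rightarrow> ('v \<Rightarrow> 'v)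
    \<Rightarrow> ('v, 'k) tensor \<Rightarrow> ('v, 'k) tensor" where
  "tensor_slot sv n V k f F =
     (\<lambda>\<phi>. if multilinear_on sv (*) n V \<phi> then F (\<lambda>v. \<phi> (v(k := f (v k)))) else 0)"

text \<open>\<open>x = (y\<^sub>0, \<dots>, y\<^sub>n\<^sub>-\<^sub>1)\<close> acts by \<open>\<Sum>\<^sub>k Id \<otimes> \<dots> \<otimes> \<rho>\<^sub>k(y\<^sub>k) \<otimes> \<dots> \<otimes> Id\<close>, where \<open>S k\<close> is the \<open>k\<close>-th
  summand of the Lie algebra.\<close>

definition tensor_rep ::
  "('k::field \<Rightarrow> 'v \<Rightarrow> 'v) \<Rightarrow> nat \<Rightarrow> (nat \<Rightarrow> 'v::ab_group_add set) \<Rightarrow> (nat \<Rightarrow> 'g::ab_group_add set)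
    \<Rightarrow> (nat \<Rightarrow> 'g \<Rightarrow> 'v \<Rightarrow> 'v) \<Rightarrow> 'g \<Rightarrow> ('v, 'k) tensor \<Rightarrow> ('v, 'k) tensor" where
  "tensor_rep sv n V S \<rho> x F =
     (\<Sum>k<n. tensor_slot sv n V k (\<rho> k (component n S x k)) F)"


subsection \<open>The universal property\<close>

lemma vector_space_fun_scale: "vector_space (fun_scale :: 'k::field \<Rightarrow> ('a \<Rightarrow> 'k) \<Rightarrow> 'a \<Rightarrow> 'k)"
  by unfold_locales (auto simp: fun_scale_def fun_eq_iff algebra_simps)

lemma multilinear_pure_tensor:
  "multilinear_on sv fun_scale n V (pure_tensor sv n V)"
  by (auto simp: multilinear_on_def linear_on_def pure_tensor_def fun_scale_def fun_eq_iff)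

lemma tensor_space_universal:
  fixes sv :: "'k::field \<Rightarrow> 'v::ab_group_add \<Rightarrow> 'v" and sw :: "'k \<Rightarrow> 'w::ab_group_add \<Rightarrow> 'w"
  assumes sv: "vector_space sv" and sw: "vector_space sw"
    and f: "multilinear_on sv sw n V f"
  shows "\<exists>!g. g \<in> extensional (tensor_space sv n V) \<and>
           linear_on fun_scale sw (tensor_space sv n V) UNIV g \<and>
           (\<forall>v \<in> (\<Pi>\<^sub>E k\<in>{..<n}. V k). g (pure_tensor sv n V v) = f v)"
proof -
  interpret T: vector_space "fun_scale :: 'k \<Rightarrow> ('v, 'k) tensor \<Rightarrow> ('v, 'k) tensor"
    by (rule vector_space_fun_scale)
  interpret W: vector_space sw by (rule sw)
  interpret TW: vector_space_pair "fun_scale :: 'k \<Rightarrow> ('v, 'k) tensor \<Rightarrow> ('v, 'k) tensor" sw ..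
  interpret WK: vector_space_pair sw "(*) :: 'k \<Rightarrow> 'k \<Rightarrow> 'k"
    by unfold_locales (auto simp: algebra_simps)
  let ?P = "\<Pi>\<^sub>E k\<in>{..<n}. V k"
  let ?\<tau> = "pure_tensor sv n V"
  have T: "tensor_space sv n V = T.span (?\<tau> ` ?P)"
    by (simp add: tensor_space_def tensor_subspace_def)
  obtain B where B: "B \<subseteq> ?\<tau> ` ?P" "T.independent B" "T.span B = T.span (?\<tau> ` ?P)"
  proof -
    obtain B where "B \<subseteq> ?\<tau> ` ?P" "T.independent B" "?\<tau> ` ?P \<subseteq> T.span B"
      using T.maximal_independent_subset by blast
    then show thesis using that by (meson T.span_eq T.span_superset subset_trans)
  qed
  define w where "w b = (SOME v. v \<in> ?P \<and> ?\<tau> v = b)" for b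
  have w: "w b \<in> ?P" "?\<tau> (w b) = b" if "b \<in> B" for b
    using someI_ex[of "\<lambda>v. v \<in> ?P \<and> ?\<tau> v = b"] B(1) that unfolding w_def by blast+
  define g where "g = TW.construct B (\<lambda>b. f (w b))"
  have lin: "Vector_Spaces.linear fun_scale sw g"
    unfolding g_def by (rule TW.linear_construct[OF B(2)])
  have gb: "g b = f (w b)" if "b \<in> B" for b
    unfolding g_def by (rule TW.construct_basis[OF B(2) that])
  have gv: "g (?\<tau> v) = f v" if v: "v \<in> ?P" for v
  proof (rule ccontr)
    assume ne: "g (?\<tau> v) \<noteq> f v"
    define z where "z = g (?\<tau> v) - f v"
    have z: "z \<noteq> 0" using ne by (simp add: z_def)
    have ind: "W.independent {z}" using z by (simp add: W.dependent_single)
    define l where "l = WK.construct {z} (\<lambda>_. 1)"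
    have l: "Vector_Spaces.linear sw (*) l" unfolding l_def by (rule WK.linear_construct[OF ind])
    have lz: "l z = 1" unfolding l_def by (rule WK.construct_basis[OF ind]) simp
    have ml: "multilinear_on sv (*) n V (\<lambda>u. l (f u))"
      using f l by (auto simp: multilinear_on_def linear_on_def WK.linear_add WK.linear_scale)
    have "?\<tau> v \<in> T.span B" unfolding B(3) by (intro T.span_base imageI v)
    then obtain t r where t: "finite t" "t \<subseteq> B" "?\<tau> v = (\<Sum>a\<in>t. fun_scale (r a) a)"
      unfolding T.span_explicit by auto
    have ev: "(\<Sum>a\<in>t. fun_scale (r a) a) \<phi> = (\<Sum>a\<in>t. r a * a \<phi>)" for \<phi> :: "(nat \<Rightarrow> 'v) \<Rightarrow> 'k"
      using t(1) by (induction t rule: finite_induct) (auto simp: fun_scale_def)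
    have at: "a (\<lambda>u. l (f u)) = l (f (w a))" if "a \<in> t" for a
    proof -
      have "a (\<lambda>u. l (f u)) = ?\<tau> (w a) (\<lambda>u. l (f u))" using w(2) that t(2) by auto
      also have "\<dots> = l (f (w a))" using ml by (simp add: pure_tensor_def)
      finally show ?thesis .
    qed
    have "l (f v) = ?\<tau> v (\<lambda>u. l (f u))" using ml by (simp add: pure_tensor_def)
    also have "\<dots> = (\<Sum>a\<in>t. r a * a (\<lambda>u. l (f u)))" by (simp only: t(3) ev)
    also have "\<dots> = (\<Sum>a\<in>t. r a * l (f (w a)))" using at by (intro sum.cong) auto
    also have "\<dots> = (\<Sum>a\<in>t. r a * l (g a))" using gb t(2) by (intro sum.cong) auto
    also have "\<dots> = l (\<Sum>a\<in>t. sw (r a) (g a))"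
      by (simp add: WK.linear_sum[OF l] WK.linear_scale[OF l])
    also have "\<dots> = l (g (\<Sum>a\<in>t. fun_scale (r a) a))"
      by (simp add: TW.linear_sum[OF lin] TW.linear_scale[OF lin])
    also have "\<dots> = l (g (?\<tau> v))" by (simp only: t(3))
    finally have "l z = 0" by (simp add: z_def WK.linear_diff[OF l])
    with lz show False by simp
  qed
  show ?thesis
  proof (rule ex1I[of _ "restrict g (tensor_space sv n V)"], intro conjI ballI)
    show "restrict g (tensor_space sv n V) \<in> extensional (tensor_space sv n V)" by simp
    show "linear_on fun_scale sw (tensor_space sv n V) UNIV (restrict g (tensor_space sv n V))"
      by (auto simp: linear_on_def T T.span_add T.span_scale TW.linear_add[OF lin]
          TW.linear_scale[OF lin])
    show "restrict g (tensor_space sv n V) (?\<tau> v) = f v" if "v \<in> ?P" for v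
      using gv[OF that] that by (simp add: T T.span_base)
  next
    fix h assume h: "h \<in> extensional (tensor_space sv n V) \<and>
      linear_on fun_scale sw (tensor_space sv n V) UNIV h \<and> (\<forall>v \<in> ?P. h (?\<tau> v) = f v)"
    have h0: "h 0 = 0"
    proof -
      have "(0 :: ('v, 'k) tensor) \<in> tensor_space sv n V" by (simp add: T T.span_zero)
      then have "h (0 + 0) = h 0 + h 0" using h unfolding linear_on_def by blast
      then show ?thesis by simp
    qed
    have "x \<in> tensor_space sv n V \<and> h x = g x" if "x \<in> T.span (?\<tau> ` ?P)" for x
      using that
    proof (induction rule: T.span_induct_alt)
      case base
      have "(0 :: ('v, 'k) tensor) \<in> tensor_space sv n V" by (simp only: T T.span_zero)
      then show ?case by (simp only: h0 TW.linear_0[OF lin])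
    next
      case (step c x y)
      have x: "x \<in> tensor_space sv n V" unfolding T by (rule T.span_base) (rule step(1))
      have cx: "fun_scale c x \<in> tensor_space sv n V"
        using x unfolding T by (rule T.span_scale)
      have y: "y \<in> tensor_space sv n V" "h y = g y" using step(2) by blast+
      have "fun_scale c x + y \<in> tensor_space sv n V"
        using cx y(1) unfolding T by (rule T.span_add)
      moreover have "h x = g x" using step(1) h gv by fastforce
      moreover have "h (fun_scale c x + y) = h (fun_scale c x) + h y"
        using h cx y(1) unfolding linear_on_def by blast
      moreover have "h (fun_scale c x) = sw c (h x)"
        using h x unfolding linear_on_def by blast
      ultimately show ?case
        by (simp only: TW.linear_add[OF lin] TW.linear_scale[OF lin] y(2))
    qed
    then show "h = restrict g (tensor_space sv n V)"
      using h by (intro extensionalityI[of h "tensor_space sv n V"]) (simp_all add: T)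
  qed
qed

lemma linear_tensor_slot: "linear_on fun_scale fun_scale UNIV UNIV (tensor_slot sv n V k f)"
  by (auto simp: linear_on_def tensor_slot_def fun_scale_def fun_eq_iff)

lemma tensor_slot_pure_tensor:
  assumes k: "k < n" and f: "linear_on sv sv (V k) (V k) f"
    and v: "v \<in> (\<Pi>\<^sub>E k\<in>{..<n}. V k)"
  shows "tensor_slot sv n V k f (pure_tensor sv n V v) = pure_tensor sv n V (v(k := f (v k)))"
proof -
  have "multilinear_on sv (*) n V (\<lambda>v. \<phi> (v(k := f (v k))))" if \<phi>: "multilinear_on sv (*) n V \<phi>" for \<phi>
    unfolding multilinear_on_def
  proof (intro ballI allI impI)
    fix u j assume u: "u \<in> (\<Pi>\<^sub>E k\<in>{..<n}. V k)" and j: "j < n"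
    show "linear_on sv (*) (V j) UNIV (\<lambda>a. \<phi> ((u(j := a))(k := f ((u(j := a)) k))))"
    proof (cases "j = k")
      case True
      have "linear_on sv (*) (V k) UNIV (\<lambda>a. \<phi> (u(k := a)))"
        using \<phi> u k unfolding multilinear_on_def by blast
      with f show ?thesis unfolding linear_on_def Pi_iff using True by auto
    next
      case False
      have "f (u k) \<in> V k" using f u k by (auto simp: linear_on_def)
      with u k have "u(k := f (u k)) \<in> (\<Pi>\<^sub>E k\<in>{..<n}. V k)"
        by (auto simp: PiE_iff extensional_def)
      with \<phi> j have "linear_on sv (*) (V j) UNIV (\<lambda>a. \<phi> (u(k := f (u k), j := a)))"
        unfolding multilinear_on_def by blast
      with False show ?thesis by (simp add: fun_upd_twist)
    qed
  qed
  then show ?thesis by (auto simp: tensor_slot_def pure_tensor_def fun_eq_iff)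
qed

end

theory Submission
  imports Defs
begin

text \<open>
  Simultaneous eigenspaces of a family of linear operators for pairwise distinct eigenvalue
  functions are independent.  Hence, as soon as a module is spanned by nonzero subspaces
  contained in weight spaces for pairwise distinct forms, these subspaces are exactly its weight
  spaces and there are no other weights.  For \<open>V\<^sub>k\<close> this applies to the images under \<open>\<beta>\<^sub>k\<^sup>k\<close> of the
  weight spaces, since \<open>\<beta>\<^sub>k\<^sup>k\<close> intertwines \<open>\<rho>\<^sub>k x\<close> with the action of \<open>\<alpha>\<^sup>k x\<close>; for the tensor
  product it applies to the tensor products of weight spaces, which span by multilinearity.
\<close>

text \<open>The criterion indexes pieces by forms, whereas the tensor product is cut up by tuples of
  weights, so distinct tuples must first be shown to have distinct total forms. For several modules
  over one common Cartan subalgebra this can fail, and a weight space is then a sum of several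
  products. Here each form of a tuple lives on its own summand of the Cartan subalgebra, and
  restricting the total form to that summand returns it. The induced bracket is built from
  \<open>inv \<alpha>\<close> and carries information only once \<alpha> is known to be bijective.
  In arbitrary dimension this takes two arguments: the cyclic decomposition gives surjectivity, the
  absence of proper Hom-ideals gives injectivity. The tensor action respects brackets because
  distinct summands commute, so that taking components is a homomorphism. That a product of nonzero
  weight spaces is nonzero is a separate point: tensors are functionals on multilinear forms, and a
  form has to be exhibited on which a given pure tensor does not vanish.\<close>

interpretation tensor: vector_space "fun_scale :: 'k::field \<Rightarrow> ('a \<Rightarrow> 'k) \<Rightarrow> 'a \<Rightarrow> 'k"
  by (rule vector_space_fun_scale)

section \<open>Weight spaces\<close>

lemma (in vector_space) span_UN_subspaces_sum:
  assumes U: "\<And>i. i \<in> I \<Longrightarrow> subspace (U i)" and v: "v \<in> span (\<Union>i\<in>I. U i)"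
  shows "\<exists>J u. finite J \<and> J \<subseteq> I \<and> (\<forall>j\<in>J. u j \<in> U j) \<and> v = sum u J"
  using v
proof (induction rule: span_induct_alt)
  case base
  show ?case by (intro exI[of _ "{}"]) simp
next
  case (step c x y)
  from step(1) obtain i where i: "i \<in> I" "x \<in> U i" by blast
  from step(2) obtain J u where J: "finite J" "J \<subseteq> I" "\<forall>j\<in>J. u j \<in> U j" "y = sum u J" by blast
  \<comment> \<open>The new term goes into slot \<open>i\<close> whether or not \<open>i\<close> is
    already in \<open>J\<close>. The second conditional is there because \<open>u\<close> has no
    prescribed value outside \<open>J\<close>.\<close>
  define u' where "u' j = (if j = i then scale c x else 0) + (if j \<in> J then u j else 0)" for j
  have "sum u' (insert i J) = scale c x + sum u J"
    using J(1) unfolding u'_def sum.distrib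
    by (intro arg_cong2[of _ _ _ _ "(+)"] sum.mono_neutral_cong_right) auto
  moreover have "u' j \<in> U j" if "j \<in> insert i J" for j
    using that i J U unfolding u'_def
    by (auto intro!: subspace_add subspace_scale subspace_0)
  ultimately show ?case using i J
    by (intro exI[of _ "insert i J"] exI[of _ u']) auto
qed

text \<open>Serves to exchange weight spaces for tensor subspaces that are known to agree with them
  only at the weights.\<close>

lemma internal_direct_sum_cong:
  assumes "\<And>i. i \<in> I \<Longrightarrow> U i = U' i"
  shows "internal_direct_sum s V I U \<longleftrightarrow> internal_direct_sum s V I U'"
proof -
  have "(\<forall>j\<in>J. u j \<in> U j) \<longleftrightarrow> (\<forall>j\<in>J. u j \<in> U' j)" if "J \<subseteq> I" for J u
    using assms that by blast
  then show ?thesis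
    unfolding internal_direct_sum_def using assms by (simp cong: conj_cong)
qed

lemma linear_on_0:
  assumes "vector_space sa" "vector_space sb" "linear_on sa sb S T f" "0 \<in> S"
  shows "f 0 = 0"
proof -
  interpret A: vector_space sa by fact
  interpret B: vector_space sb by fact
  have "f (sa 0 0) = sb 0 (f 0)" using assms(3,4) unfolding linear_on_def by blast
  then show ?thesis by simp
qed

lemma linear_on_sum:
  assumes "vector_space sa" "vector_space sb" "linear_on sa sb S T f" "module.subspace sa S"
    and "finite J" "\<And>j. j \<in> J \<Longrightarrow> u j \<in> S"
  shows "f (sum u J) = (\<Sum>j\<in>J. f (u j))"
proof -
  interpret A: vector_space sa by fact
  show ?thesis using assms(5,6)
  proof (induction J rule: finite_induct)
    case empty
    show ?case using linear_on_0[OF assms(1-3)] A.subspace_0[OF assms(4)] by simp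
  next
    case (insert x F)
    have "sum u F \<in> S" using insert by (intro A.subspace_sum[OF assms(4)]) auto
    then show ?case using insert assms(3) unfolding linear_on_def by auto
  qed
qed

text \<open>Retains of a representation just one linear operator on \<open>V\<close> for each
  \<open>h\<close>, so that the same facts apply to every \<open>V k\<close> and to the tensor
  product.\<close>

locale operator_family = vector_space sv
  for sv :: "'k::field \<Rightarrow> 'v::ab_group_add \<Rightarrow> 'v" +
  fixes H :: "'g::ab_group_add set" and V :: "'v set" and \<rho> :: "'g \<Rightarrow> 'v \<Rightarrow> 'v"
  assumes subspace_V: "subspace V"
    and linear_\<rho>: "h \<in> H \<Longrightarrow> linear_on sv sv V V (\<rho> h)"
begin

abbreviation "ws \<equiv> weight_space sv H V \<rho>"

lemma \<rho>_0: "h \<in> H \<Longrightarrow> \<rho> h 0 = 0"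
  using linear_on_0[OF vector_space_axioms vector_space_axioms linear_\<rho>] subspace_0[OF subspace_V]
  by blast

lemma \<rho>_simps:
  assumes "h \<in> H" "v \<in> V"
  shows "w \<in> V \<Longrightarrow> \<rho> h (v + w) = \<rho> h v + \<rho> h w" "\<rho> h (sv c v) = sv c (\<rho> h v)"
  using linear_\<rho>[OF assms(1)] assms(2) by (auto simp: linear_on_def)

lemma subspace_weight_space: "subspace (ws \<mu>)"
  using subspace_0[OF subspace_V]
  by (auto simp: subspace_def weight_space_def \<rho>_0 \<rho>_simps scale_right_distrib scale_left_commute
      intro: subspace_add[OF subspace_V] subspace_scale[OF subspace_V])

lemma weight_spaces_independent:
  assumes "finite J" "J \<subseteq> extensional H" "\<And>\<mu>. \<mu> \<in> J \<Longrightarrow> u \<mu> \<in> ws \<mu>" "sum u J = 0" "\<mu> \<in> J"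
  shows "u \<mu> = 0"
  using assms
proof (induction J arbitrary: u \<mu> rule: finite_induct)
  case empty
  then show ?case by simp
next
  case (insert \<nu> J)
  have V: "u \<mu> \<in> V" if "\<mu> \<in> insert \<nu> J" for \<mu>
    using insert.prems(2)[OF that] by (simp add: weight_space_def)
  have J0: "u \<mu> = 0" if \<mu>: "\<mu> \<in> J" for \<mu>
  proof -
    \<comment> \<open>Applying \<open>\<rho> h - \<nu> h\<close> to the relation removes the term \<open>u \<nu>\<close>.\<close>
    have eq: "sv (\<mu> h - \<nu> h) (u \<mu>) = 0" if h: "h \<in> H" for h
    proof -
      have "(\<Sum>\<mu>\<in>insert \<nu> J. sv (\<mu> h) (u \<mu>)) = (\<Sum>\<mu>\<in>insert \<nu> J. \<rho> h (u \<mu>))"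
        using insert.prems(2) h by (intro sum.cong) (auto simp: weight_space_def)
      also have "\<dots> = \<rho> h (sum u (insert \<nu> J))"
        using linear_on_sum[OF vector_space_axioms vector_space_axioms linear_\<rho>[OF h] subspace_V,
            of "insert \<nu> J" u] V insert.hyps by simp
      also have "\<dots> = 0"
        using \<rho>_0[OF h] insert.prems(3) by simp
      finally have "(\<Sum>\<mu>\<in>insert \<nu> J. sv (\<mu> h) (u \<mu>)) - sv (\<nu> h) (sum u (insert \<nu> J)) = 0"
        using insert.prems(3) by simp
      then have "(\<Sum>\<mu>\<in>insert \<nu> J. sv (\<mu> h - \<nu> h) (u \<mu>)) = 0"
        by (simp only: scale_sum_right sum_subtractf[symmetric] scale_left_diff_distrib)
      then have "(\<Sum>\<mu>\<in>J. sv (\<mu> h - \<nu> h) (u \<mu>)) = 0"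
        using insert.hyps by simp
      from insert.IH[OF _ _ this \<mu>] show ?thesis
        using insert.prems subspace_scale[OF subspace_weight_space] by auto
    qed
    have "\<mu> \<noteq> \<nu>" using \<mu> insert.hyps by blast
    \<comment> \<open>Extensionality matters here: two different forms that are normalised outside
      \<open>H\<close> must differ at a point of \<open>H\<close>.\<close>
    then obtain h where "h \<in> H" "\<mu> h \<noteq> \<nu> h"
      using insert.prems(1) \<mu> extensionalityI[of \<mu> H \<nu>] by blast
    with eq[of h] show ?thesis by simp
  qed
  moreover have "u \<nu> = 0" using insert.prems(3) insert.hyps J0 by simp
  ultimately show ?case using insert.prems(4) by blast
qed

lemma weight_space_decomposition:
  assumes I: "I \<subseteq> dual_on s H"
    and W: "\<And>\<mu>. \<mu> \<in> I \<Longrightarrow> subspace (W \<mu>)" "\<And>\<mu>. \<mu> \<in> I \<Longrightarrow> W \<mu> \<subseteq> ws \<mu>"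
      "\<And>\<mu>. \<mu> \<in> I \<Longrightarrow> W \<mu> \<noteq> {0}"
    and V: "V \<subseteq> span (\<Union>\<mu>\<in>I. W \<mu>)"
  shows "weights s sv H V \<rho> = I" and "\<And>\<mu>. \<mu> \<in> I \<Longrightarrow> ws \<mu> = W \<mu>"
    and "internal_direct_sum sv V I ws"
proof -
  have ext: "\<mu> \<in> extensional H" if "\<mu> \<in> dual_on s H" for \<mu>
    using that by (simp add: dual_on_def)
  have key: "v = 0 \<or> \<mu> \<in> I \<and> v \<in> W \<mu>" if \<mu>: "\<mu> \<in> extensional H" and v: "v \<in> ws \<mu>" for \<mu> v
  proof -
    have "v \<in> span (\<Union>\<mu>\<in>I. W \<mu>)" using v V by (auto simp: weight_space_def)
    from span_UN_subspaces_sum[OF W(1) this] obtain J u where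
      J: "finite J" "J \<subseteq> I" "\<forall>j\<in>J. u j \<in> W j" "v = sum u J" by auto
    \<comment> \<open>For a weight vector \<open>v\<close> the relation
      \<open>sum u J - v = 0\<close> is one between weight vectors of distinct weights. Its entry at
      \<mu> is \<open>- v\<close>, plus \<open>u \<mu>\<close> if \<mu> occurs in \<open>J\<close>.
      As it vanishes, \<open>v\<close> is zero or equals \<open>u \<mu>\<close> and lies in the
      piece.\<close>
    define u' where "u' j = (if j = \<mu> then - v else 0) + (if j \<in> J then u j else 0)" for j
    have "sum u' (insert \<mu> J) = - v + sum u J"
      using J(1) unfolding u'_def sum.distrib
      by (intro arg_cong2[of _ _ _ _ "(+)"] sum.mono_neutral_cong_right) auto
    moreover have "u' j \<in> ws j" if "j \<in> insert \<mu> J" for j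
      using that J W(2) v unfolding u'_def
      by (auto intro!: subspace_diff subspace_neg subspace_add subspace_0 subspace_weight_space)
    moreover have "insert \<mu> J \<subseteq> extensional H" using \<mu> J(2) I ext by blast
    ultimately have "u' \<mu> = 0"
      using weight_spaces_independent[of "insert \<mu> J" u' \<mu>] J by auto
    then show ?thesis using J by (auto simp: u'_def split: if_splits)
  qed
  show eq: "ws \<mu> = W \<mu>" if "\<mu> \<in> I" for \<mu>
    using key[of \<mu>] W(1,2)[OF that] ext I that subspace_0 by blast
  show "weights s sv H V \<rho> = I"
  proof
    show "weights s sv H V \<rho> \<subseteq> I"
    proof
      fix \<mu> assume "\<mu> \<in> weights s sv H V \<rho>"
      then have \<mu>: "\<mu> \<in> dual_on s H" "ws \<mu> \<noteq> {0}" by (auto simp: weights_def)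
      then obtain v where "v \<in> ws \<mu>" "v \<noteq> 0" using subspace_0[OF subspace_weight_space] by blast
      with key ext \<mu>(1) show "\<mu> \<in> I" by blast
    qed
    show "I \<subseteq> weights s sv H V \<rho>" using I W(3) eq by (auto simp: weights_def)
  qed
  have "span (\<Union>\<mu>\<in>I. W \<mu>) \<subseteq> V"
    using W(2) by (intro span_minimal subspace_V) (auto simp: weight_space_def)
  with V have "V = span (\<Union>\<mu>\<in>I. ws \<mu>)" using eq by auto
  moreover have "\<forall>J u. finite J \<and> J \<subseteq> I \<and> (\<forall>j\<in>J. u j \<in> ws j) \<and> sum u J = 0 \<longrightarrow> (\<forall>j\<in>J. u j = 0)"
  proof (intro allI impI ballI)
    fix J u \<mu>
    assume *: "finite J \<and> J \<subseteq> I \<and> (\<forall>j\<in>J. u j \<in> ws j) \<and> sum u J = 0" and \<mu>: "\<mu> \<in> J"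
    show "u \<mu> = 0"
      by (rule weight_spaces_independent[of J u, OF _ _ _ _ \<mu>]) (use * I ext in auto)
  qed
  ultimately show "internal_direct_sum sv V I ws"
    unfolding internal_direct_sum_def using subspace_weight_space by (intro conjI ballI)
qed

end

section \<open>Direct sums indexed by an initial segment\<close>

locale direct_sum = vector_space s
  for s :: "'k::field \<Rightarrow> 'g::ab_group_add \<Rightarrow> 'g" +
  fixes n :: nat and S :: "nat \<Rightarrow> 'g set"
  assumes direct: "internal_direct_sum s UNIV {..<n} S"
begin

lemma subspace_S: "k < n \<Longrightarrow> subspace (S k)"
  using direct by (auto simp: internal_direct_sum_def)

lemma decomposition_unique:
  assumes "y \<in> (\<Pi>\<^sub>E k\<in>{..<n}. S k)" "z \<in> (\<Pi>\<^sub>E k\<in>{..<n}. S k)" "sum y {..<n} = sum z {..<n}"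
  shows "y = z"
proof -
  have "(\<Sum>k<n. y k - z k) = 0" using assms(3) by (simp add: sum_subtractf)
  moreover have "\<forall>k\<in>{..<n}. y k - z k \<in> S k"
    using assms(1,2) subspace_diff[OF subspace_S] by (auto simp: PiE_iff)
  ultimately have "\<forall>k\<in>{..<n}. y k - z k = 0"
    using direct[unfolded internal_direct_sum_def]
    by (metis (no_types, lifting) finite_lessThan subset_refl)
  then show ?thesis using assms(1,2) by (intro PiE_ext[of y _ S]) auto
qed

lemma decomposition_exists: "\<exists>y. y \<in> (\<Pi>\<^sub>E k\<in>{..<n}. S k) \<and> sum y {..<n} = x"
proof -
  have "x \<in> span (\<Union>k\<in>{..<n}. S k)" using direct by (auto simp: internal_direct_sum_def)
  from span_UN_subspaces_sum[OF _ this] obtain J u where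
    J: "finite J" "J \<subseteq> {..<n}" "\<forall>j\<in>J. u j \<in> S j" "x = sum u J" using subspace_S by auto
  define y where "y = (\<lambda>k\<in>{..<n}. if k \<in> J then u k else 0)"
  have "y \<in> (\<Pi>\<^sub>E k\<in>{..<n}. S k)" using J subspace_0[OF subspace_S] by (auto simp: y_def)
  moreover have "sum y {..<n} = x"
    unfolding J(4) y_def using J(2) by (intro sum.mono_neutral_cong_right) auto
  ultimately show ?thesis by blast
qed

lemma component_unique:
  assumes "y \<in> (\<Pi>\<^sub>E k\<in>{..<n}. S k)" "sum y {..<n} = x"
  shows "component n S x = y"
  unfolding component_def using assms decomposition_unique by (intro the_equality) auto

lemma component_PiE: "component n S x \<in> (\<Pi>\<^sub>E k\<in>{..<n}. S k)"
  and sum_component: "sum (component n S x) {..<n} = x"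
  using decomposition_exists[of x] component_unique by auto

lemma component_in: "k < n \<Longrightarrow> component n S x k \<in> S k"
  using component_PiE[of x] by auto

text \<open>Lets \<open>y\<close> take any values from \<open>n\<close> on, unlike the members of
  the extensional product. Components are thus computed by exhibiting a candidate for each of
  them.\<close>

lemma component_eqI:
  assumes "\<And>j. j < n \<Longrightarrow> y j \<in> S j" "(\<Sum>j<n. y j) = x" "k < n"
  shows "component n S x k = y k"
  using component_unique[of "restrict y {..<n}" x] assms by auto

lemma component_add: "k < n \<Longrightarrow> component n S (x + y) k = component n S x k + component n S y k"
  by (rule component_eqI[of "\<lambda>k. component n S x k + component n S y k"])
    (auto simp: sum.distrib sum_component component_in intro: subspace_add[OF subspace_S])

lemma component_scale: "k < n \<Longrightarrow> component n S (s c x) k = s c (component n S x k)"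
  by (rule component_eqI[of "\<lambda>k. s c (component n S x k)"])
    (auto simp: scale_sum_right[symmetric] sum_component component_in
      intro: subspace_scale[OF subspace_S])

lemma component_single:
  assumes "j < n" "x \<in> S j" "k < n"
  shows "component n S x k = (if k = j then x else 0)"
  by (rule component_eqI[of "\<lambda>k. if k = j then x else 0"])
    (use assms subspace_0[OF subspace_S] in auto)

text \<open>The component of \<open>x\<close> at \<open>i\<close> is \<open>x\<close> when
  \<open>x\<close> is seen in \<open>S i\<close>, and 0 when it is seen in
  \<open>S j\<close>.\<close>

lemma S_disjoint:
  assumes "i < n" "j < n" "i \<noteq> j" "x \<in> S i" "x \<in> S j"
  shows "x = 0"
  using component_single[of i x i] component_single[of j x i] assms by simp

text \<open>The tensor action takes components along the ideals, the forms take them along the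
  Cartan subalgebras. Both are the same on \<open>sum_of n H\<close>: a decomposition along
  \<open>H\<close> is also one along \<open>S\<close>, where decompositions are unique.\<close>

lemma component_subfamily:
  assumes H: "\<And>k. k < n \<Longrightarrow> H k \<subseteq> S k" and x: "x \<in> sum_of n H"
  shows "component n H x = component n S x" "k < n \<Longrightarrow> component n S x k \<in> H k"
proof -
  from x obtain y where y: "y \<in> (\<Pi>\<^sub>E k\<in>{..<n}. H k)" "x = sum y {..<n}"
    by (auto simp: sum_of_def)
  have sub: "z \<in> (\<Pi>\<^sub>E k\<in>{..<n}. S k)" if "z \<in> (\<Pi>\<^sub>E k\<in>{..<n}. H k)" for z
    using that H by (auto simp: PiE_iff)
  have S: "component n S x = y" using y sub by (intro component_unique) auto
  have "component n H x = y"
    unfolding component_def using y sub decomposition_unique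
    by (intro the_equality) auto
  then show "component n H x = component n S x" using S by simp
  show "k < n \<Longrightarrow> component n S x k \<in> H k" using S y by auto
qed

lemma sum_of_iff:
  assumes H: "\<And>k. k < n \<Longrightarrow> H k \<subseteq> S k"
  shows "x \<in> sum_of n H \<longleftrightarrow> (\<forall>k<n. component n S x k \<in> H k)"
proof
  show "x \<in> sum_of n H \<Longrightarrow> \<forall>k<n. component n S x k \<in> H k"
    using component_subfamily(2)[of H x] H by blast
  assume "\<forall>k<n. component n S x k \<in> H k"
  then have "component n S x \<in> (\<Pi>\<^sub>E k\<in>{..<n}. H k)" using component_PiE[of x] by (auto simp: PiE_iff)
  then show "x \<in> sum_of n H" unfolding sum_of_def using sum_component[of x]
    by (metis (no_types, lifting) image_eqI)
qed

end

section \<open>Twisting a Lie algebra by its Hom-structure\<close>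

lemma linear_inv:
  assumes f: "Vector_Spaces.linear s s f" and "bij f"
  shows "Vector_Spaces.linear s s (inv f)"
proof -
  have *: "f (inv f x) = x" "inv f (f x) = x" for x
    using \<open>bij f\<close> by (simp_all add: bij_is_surj surj_f_inv_f bij_is_inj)
  have "inv f (x + y) = inv f x + inv f y" for x y
  proof -
    have "inv f (x + y) = inv f (f (inv f x + inv f y))"
      using f by (simp add: Vector_Spaces.linear_iff *(1))
    then show ?thesis by (simp only: *(2))
  qed
  moreover have "inv f (s c x) = s c (inv f x)" for c x
  proof -
    have "inv f (s c x) = inv f (f (s c (inv f x)))"
      using f by (simp add: Vector_Spaces.linear_iff *(1))
    then show ?thesis by (simp only: *(2))
  qed
  ultimately show ?thesis using f by (simp add: Vector_Spaces.linear_iff)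
qed

lemma linear_funpow:
  assumes "Vector_Spaces.linear s s f"
  shows "Vector_Spaces.linear s s (f ^^ k)"
  using assms by (induction k) (auto simp: Vector_Spaces.linear_iff)

context simple_multiplicative_hom_lie_algebra
begin

interpretation VP: vector_space_pair scale scale ..

text \<open>The image of \<alpha> contains every summand, since \<alpha> carries each summand onto
  the next and, by periodicity, the last one onto \<open>I\<close>; the summands span, so \<alpha>
  is onto. By multiplicativity the kernel is a Hom-ideal, and it is not the whole space because
  \<alpha> maps onto a nonzero space; hence it is zero.\<close>

lemma bij_twist:
  assumes dec: "internal_direct_sum scale UNIV {..<n} (\<lambda>k. (\<alpha> ^^ k) ` I)"
    and period: "(\<alpha> ^^ n) ` I = I" and nontrivial: "(UNIV :: 'b set) \<noteq> {0}"
  shows "bij \<alpha>"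
proof -
  let ?U = "\<Union>k\<in>{..<n}. (\<alpha> ^^ k) ` I"
  have span: "span ?U = UNIV" using dec by (simp add: internal_direct_sum_def)
  have "?U \<subseteq> \<alpha> ` ?U"
  proof (intro UN_least subsetI)
    fix k x assume k: "k \<in> {..<n}" and x: "x \<in> (\<alpha> ^^ k) ` I"
    show "x \<in> \<alpha> ` ?U"
    proof (cases k)
      case 0
      obtain m where m: "n = Suc m" using k by (cases n) auto
      have "x \<in> \<alpha> ` ((\<alpha> ^^ m) ` I)" using x 0 period m by (auto simp: image_image)
      then show ?thesis using m by blast
    next
      case (Suc m)
      then have "x \<in> \<alpha> ` ((\<alpha> ^^ m) ` I)" using x by (auto simp: image_image)
      moreover have "m \<in> {..<n}" using k Suc by simp
      ultimately show ?thesis by blast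
    qed
  qed
  then have "span ?U \<subseteq> \<alpha> ` span ?U"
    unfolding VP.linear_span_image[OF linear_twist, symmetric] by (rule span_mono)
  then have surj: "surj \<alpha>" using span by auto
  have \<alpha>0: "\<alpha> 0 = 0" by (rule VP.linear_0[OF linear_twist])
  have "hom_ideal {x. \<alpha> x = 0}"
    unfolding hom_ideal_def
    using VP.linear_0[OF linear_left] \<alpha>0
    by (auto simp: subspace_def multiplicative VP.linear_add[OF linear_twist]
        VP.linear_scale[OF linear_twist])
  then have "{x. \<alpha> x = 0} = {0} \<or> {x. \<alpha> x = 0} = UNIV" by (rule no_proper_ideals)
  moreover have "{x. \<alpha> x = 0} \<noteq> UNIV"
  proof
    assume "{x. \<alpha> x = 0} = UNIV"
    then have "range \<alpha> \<subseteq> {0}" by auto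
    with surj nontrivial show False by auto
  qed
  ultimately have "inj \<alpha>"
    unfolding VP.linear_inj_iff_eq_0[OF linear_twist] by blast
  with surj show ?thesis by (simp add: bij_def)
qed

context
  assumes bij: "bij \<alpha>"
begin

lemmas linear_inv_twist = linear_inv[OF linear_twist bij]

lemma induced_bracket_linear_left: "Vector_Spaces.linear scale scale (\<lambda>x. induced_bracket brk \<alpha> x y)"
  and induced_bracket_linear_right: "Vector_Spaces.linear scale scale (induced_bracket brk \<alpha> x)"
  unfolding induced_bracket_def Vector_Spaces.linear_iff
  by (simp_all add: vector_space_axioms VP.linear_add[OF linear_left] VP.linear_scale[OF linear_left]
      VP.linear_add[OF linear_right] VP.linear_scale[OF linear_right]
      VP.linear_add[OF linear_inv_twist] VP.linear_scale[OF linear_inv_twist])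

lemma induced_bracket_skew: "induced_bracket brk \<alpha> x y = - induced_bracket brk \<alpha> y x"
  unfolding induced_bracket_def
  by (subst skew) (simp add: VP.linear_neg[OF linear_inv_twist])

text \<open>For one step both sides are \<open>brk x y\<close>: on the left \<alpha> cancels its
  inverse, on the right multiplicativity pulls \<alpha> out of the bracket before it is cancelled.
  So \<alpha> is an automorphism of the induced algebra.\<close>

lemma twist_induced_bracket:
  "(\<alpha> ^^ k) (induced_bracket brk \<alpha> x y) = induced_bracket brk \<alpha> ((\<alpha> ^^ k) x) ((\<alpha> ^^ k) y)"
proof (induction k)
  case (Suc k)
  have "\<alpha> (induced_bracket brk \<alpha> x y) = induced_bracket brk \<alpha> (\<alpha> x) (\<alpha> y)" for x y
    using bij unfolding induced_bracket_def multiplicative[symmetric]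
    by (simp add: bij_is_surj surj_f_inv_f bij_is_inj)
  then show ?case using Suc by simp
qed simp

end

end

section \<open>Twisted forms and twisted modules\<close>

lemma inv_into_funpow_cancel:
  assumes f: "bij_betw f A A" and x: "x \<in> A"
  shows "(inv_into A f ^^ k) ((f ^^ k) x) = x"
proof (induction k)
  case (Suc k)
  have "(f ^^ k) x \<in> A" using bij_betw_funpow[OF f, of k] x by (auto simp: bij_betw_def)
  then have "inv_into A f (f ((f ^^ k) x)) = (f ^^ k) x"
    using f by (simp add: bij_betw_def)
  with Suc show ?case by (simp add: funpow_swap1)
qed simp

lemma GL_on_funpow:
  assumes "\<beta> \<in> GL_on s V"
  shows "\<beta> ^^ k \<in> GL_on s V"
proof (induction k)
  case 0
  show ?case by (auto simp: GL_on_def linear_on_def bij_betw_def)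
next
  case (Suc k)
  then have "bij_betw (\<beta> ^^ Suc k) V V"
    using assms unfolding GL_on_def funpow.simps(2) by (auto intro: bij_betw_trans)
  with Suc assms show ?case
    unfolding GL_on_def linear_on_def by (auto simp: Pi_iff comp_def)
qed

lemma twisted_form_apply:
  assumes "bij \<alpha>" "h \<in> H"
  shows "twisted_form \<alpha> H k \<mu> ((\<alpha> ^^ k) h) = \<mu> h"
  using assms inv_into_funpow_cancel[of \<alpha> UNIV h k] by (simp add: twisted_form_def)

lemma twisted_form_dual:
  assumes \<alpha>: "bij \<alpha>" "Vector_Spaces.linear s s \<alpha>" and H: "module.subspace s H"
    and \<mu>: "\<mu> \<in> dual_on s H"
  shows "twisted_form \<alpha> H k \<mu> \<in> dual_on s ((\<alpha> ^^ k) ` H)"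
proof -
  interpret vector_space s using \<alpha>(2) by (simp add: Vector_Spaces.linear_iff)
  note pow = linear_funpow[OF \<alpha>(2), of k]
  have "twisted_form \<alpha> H k \<mu> ((\<alpha> ^^ k) x + (\<alpha> ^^ k) y) =
      twisted_form \<alpha> H k \<mu> ((\<alpha> ^^ k) x) + twisted_form \<alpha> H k \<mu> ((\<alpha> ^^ k) y)"
    if "x \<in> H" "y \<in> H" for x y
  proof -
    have "(\<alpha> ^^ k) x + (\<alpha> ^^ k) y = (\<alpha> ^^ k) (x + y)" using pow by (simp add: Vector_Spaces.linear_iff)
    then show ?thesis
      using that \<mu> subspace_add[OF H that]
      by (simp add: twisted_form_apply[OF \<alpha>(1)] dual_on_def linear_on_def)
  qed
  moreover have "twisted_form \<alpha> H k \<mu> (s c ((\<alpha> ^^ k) x)) = c * twisted_form \<alpha> H k \<mu> ((\<alpha> ^^ k) x)"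
    if "x \<in> H" for c x
  proof -
    have "s c ((\<alpha> ^^ k) x) = (\<alpha> ^^ k) (s c x)" using pow by (simp add: Vector_Spaces.linear_iff)
    then show ?thesis
      using that \<mu> subspace_scale[OF H that]
      by (simp add: twisted_form_apply[OF \<alpha>(1)] dual_on_def linear_on_def)
  qed
  ultimately show ?thesis
    by (auto simp: dual_on_def linear_on_def) (simp add: twisted_form_def)
qed

lemma inj_on_twisted_form:
  assumes "bij \<alpha>"
  shows "inj_on (twisted_form \<alpha> H k) (extensional H)"
proof (rule inj_onI)
  fix \<mu> \<nu> :: "'a \<Rightarrow> 'b"
  assume *: "\<mu> \<in> extensional H" "\<nu> \<in> extensional H"
    and "twisted_form \<alpha> H k \<mu> = twisted_form \<alpha> H k \<nu>"
  then have "\<mu> h = \<nu> h" if "h \<in> H" for h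
    using twisted_form_apply[OF assms that] by metis
  with * show "\<mu> = \<nu>" by (rule extensionalityI)
qed

text \<open>The identity serves as \<beta>, which makes the conjugation trivial; what is left is
  \<rho> precomposed with the inverse of \<open>\<alpha> ^^ k\<close>. This is a representation
  because \<open>\<alpha> ^^ k\<close> respects the bracket.\<close>

lemma twisted_rep_exists:
  assumes \<alpha>: "bij \<alpha>" "Vector_Spaces.linear s s \<alpha>" and rep: "lie_rep s br L sv V \<rho>"
    and br: "\<And>x y. (\<alpha> ^^ k) (br x y) = br ((\<alpha> ^^ k) x) ((\<alpha> ^^ k) y)"
  shows "\<exists>\<rho>' \<beta>. lie_rep s br ((\<alpha> ^^ k) ` L) sv V \<rho>' \<and> \<beta> \<in> GL_on sv V \<and>
    twist_compatible \<alpha> k L V \<rho> \<rho>' \<beta>"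
proof (intro exI conjI)
  let ?\<rho> = "\<lambda>y. \<rho> ((inv \<alpha> ^^ k) y)"
  have *: "(inv \<alpha> ^^ k) ((\<alpha> ^^ k) x) = x" for x
    using \<alpha>(1) inv_into_funpow_cancel[of \<alpha> UNIV x k] by simp
  have inv: "Vector_Spaces.linear s s (inv \<alpha> ^^ k)"
    by (intro linear_funpow linear_inv \<alpha>)
  show "lie_rep s br ((\<alpha> ^^ k) ` L) sv V ?\<rho>"
    using rep inv
    by (auto simp: lie_rep_def linear_on_def * br[symmetric] Vector_Spaces.linear_iff)
  show "id \<in> GL_on sv V"
    by (auto simp: GL_on_def linear_on_def bij_betw_def)
  have "(inv_into V id ^^ k) v = v" if "v \<in> V" for v
    using inv_into_funpow_cancel[of id V v k] that by (simp add: bij_betw_def)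
  then show "twist_compatible \<alpha> k L V \<rho> ?\<rho> id"
    by (simp add: twist_compatible_def *)
qed

text \<open>Holds for every admissible pair \<rho>', \<beta>, not just for the one exhibited above.
  The identity for images of weight spaces is proved for every function \<mu>, weight or
  not.\<close>

lemma weight_module_twist:
  assumes \<alpha>: "bij \<alpha>" "Vector_Spaces.linear s s \<alpha>" and sv: "vector_space sv"
    and wm: "weight_module s br L H sv V \<rho>" and H: "module.subspace s H" "H \<subseteq> L"
    and rep: "lie_rep s br ((\<alpha> ^^ k) ` L) sv V \<rho>'" and \<beta>: "\<beta> \<in> GL_on sv V"
    and comp: "twist_compatible \<alpha> k L V \<rho> \<rho>' \<beta>"
  shows "weight_module s br ((\<alpha> ^^ k) ` L) ((\<alpha> ^^ k) ` H) sv V \<rho>'"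
    and "weights s sv ((\<alpha> ^^ k) ` H) V \<rho>' = twisted_form \<alpha> H k ` weights s sv H V \<rho>"
    and "(\<beta> ^^ k) ` weight_space sv H V \<rho> \<mu> =
      weight_space sv ((\<alpha> ^^ k) ` H) V \<rho>' (twisted_form \<alpha> H k \<mu>)"
proof -
  interpret vector_space sv by (rule sv)
  let ?H = "(\<alpha> ^^ k) ` H"
  let ?t = "twisted_form \<alpha> H k"
  let ?P = "weights s sv H V \<rho>"
  interpret R: operator_family sv ?H V \<rho>'
    using rep H(2) by unfold_locales (auto simp: lie_rep_def)
  define b where "b = \<beta> ^^ k"
  have b: "linear_on sv sv V V b" "bij_betw b V V"
    using GL_on_funpow[OF \<beta>, of k] by (auto simp: GL_on_def b_def)
  have \<beta>_bij: "bij_betw \<beta> V V" using \<beta> by (simp add: GL_on_def)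
  have b_in: "b v \<in> V" if "v \<in> V" for v
    using b(1) that by (auto simp: linear_on_def)
  \<comment> \<open>The compatibility relation evaluated at \<open>b v\<close>, where the inverse
    powers of \<beta> cancel.\<close>
  have intertwine: "\<rho>' ((\<alpha> ^^ k) h) (b v) = b (\<rho> h v)" if "h \<in> H" "v \<in> V" for h v
    using comp that H(2) b_in[OF that(2)] inv_into_funpow_cancel[OF \<beta>_bij that(2), of k]
    by (auto simp: twist_compatible_def b_def)
  have \<rho>_in: "\<rho> h v \<in> V" if "h \<in> H" "v \<in> V" for h v
    using wm that H(2) by (auto simp: weight_module_def lie_rep_def linear_on_def)
  have image: "b ` weight_space sv H V \<rho> \<mu> = R.ws (?t \<mu>)" for \<mu>
  proof -
    \<comment> \<open>Injectivity of \<open>b\<close> makes this an equivalence; with surjectivity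
      onto \<open>V\<close> the image is then all of the weight space and not merely contained in
      it.\<close>
    have iff: "b v \<in> R.ws (?t \<mu>) \<longleftrightarrow> v \<in> weight_space sv H V \<rho> \<mu>" if v: "v \<in> V" for v
    proof -
      have "b (\<rho> h v) = sv (\<mu> h) (b v) \<longleftrightarrow> \<rho> h v = sv (\<mu> h) v" if "h \<in> H" for h
      proof -
        have "sv (\<mu> h) (b v) = b (sv (\<mu> h) v)" using b(1) v by (simp add: linear_on_def)
        then show ?thesis
          using b(2) \<rho>_in[OF that v] subspace_scale[OF R.subspace_V v]
          by (auto simp: bij_betw_def inj_on_eq_iff)
      qed
      then show ?thesis
        using v b_in[OF v] by (simp add: weight_space_def intertwine twisted_form_apply[OF \<alpha>(1)])
    qed
    show ?thesis
    proof (intro set_eqI iffI)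
      fix w assume w: "w \<in> R.ws (?t \<mu>)"
      then have "w \<in> V" by (simp add: weight_space_def)
      then obtain v where "v \<in> V" "w = b v" using b(2) by (auto simp: bij_betw_def)
      with w iff show "w \<in> b ` weight_space sv H V \<rho> \<mu>" by blast
    qed (use iff in \<open>auto simp: weight_space_def\<close>)
  qed
  then show "(\<beta> ^^ k) ` weight_space sv H V \<rho> \<mu> = R.ws (?t \<mu>)" by (simp add: b_def)
  have dual: "?t ` ?P \<subseteq> dual_on s ?H"
    using twisted_form_dual[OF \<alpha> H(1)] by (auto simp: weights_def)
  have V: "V = span (\<Union>\<mu>\<in>?P. weight_space sv H V \<rho> \<mu>)"
    using wm by (simp add: weight_module_def internal_direct_sum_def)
  have V0: "0 \<in> V" by (rule subspace_0[OF R.subspace_V])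
  have b0: "b 0 = 0" by (rule linear_on_0[OF sv sv b(1) V0])
  have nonzero: "R.ws \<nu> \<noteq> {0}" if "\<nu> \<in> ?t ` ?P" for \<nu>
  proof -
    from that obtain \<mu> where \<mu>: "\<mu> \<in> ?P" "\<nu> = ?t \<mu>" by blast
    have ws: "weight_space sv H V \<rho> \<mu> \<subseteq> V" by (auto simp: weight_space_def)
    have "b ` weight_space sv H V \<rho> \<mu> \<noteq> b ` {0}"
      using \<mu>(1) b(2) V0 inj_on_image_eq_iff[of b V "weight_space sv H V \<rho> \<mu>" "{0}"] ws
      by (auto simp: bij_betw_def weights_def)
    then show ?thesis using image[of \<mu>] \<mu>(2) b0 by simp
  qed
  have span: "V \<subseteq> span (\<Union>\<nu>\<in>?t ` ?P. R.ws \<nu>)" (is "_ \<subseteq> span ?U")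
  proof -
    \<comment> \<open>\<open>b\<close> is linear on \<open>V\<close> only, so the induction carries
      membership in \<open>V\<close> along.\<close>
    have "v \<in> V \<and> b v \<in> span ?U" if "v \<in> span (\<Union>\<mu>\<in>?P. weight_space sv H V \<rho> \<mu>)" for v
      using that
    proof (induction rule: span_induct_alt)
      case base
      show ?case using V0 b0 span_zero by simp
    next
      case (step c x y)
      then obtain \<mu> where \<mu>: "\<mu> \<in> ?P" "x \<in> weight_space sv H V \<rho> \<mu>" by blast
      then have x: "x \<in> V" "b x \<in> ?U" using image[of \<mu>] by (auto simp: weight_space_def)
      have "b (sv c x + y) = sv c (b x) + b y"
        using b(1) x(1) step(2) subspace_scale[OF R.subspace_V x(1), of c]
        by (simp add: linear_on_def)
      moreover have "sv c x + y \<in> V"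
        by (intro subspace_add[OF R.subspace_V] subspace_scale[OF R.subspace_V] x)
          (rule conjunct1[OF step(2)])
      moreover have "sv c (b x) + b y \<in> span ?U"
        by (intro span_add span_scale span_base[OF x(2)]) (rule conjunct2[OF step(2)])
      ultimately show ?case by simp
    qed
    then have "b ` V \<subseteq> span ?U" using equalityD1[OF V] by (intro image_subsetI) (blast dest: subsetD)
    then show ?thesis using b(2) by (simp add: bij_betw_def)
  qed
  \<comment> \<open>The pieces are chosen to be the full weight spaces, so their inclusion is
    trivial; the gain is the set of weights and the direct sum.\<close>
  note dec = R.weight_space_decomposition[OF dual R.subspace_weight_space subset_refl nonzero span]
  show "weights s sv ?H V \<rho>' = ?t ` ?P" by (rule dec(1))
  then show "weight_module s br ((\<alpha> ^^ k) ` L) ?H sv V \<rho>'"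
    using rep dec(3) by (simp add: weight_module_def)
qed

section \<open>Tensor products\<close>

lemma subspace_tensor_subspace: "tensor.subspace (tensor_subspace sv n V U)"
  by (simp add: tensor_subspace_def)

lemma pure_tensor_in: "v \<in> (\<Pi>\<^sub>E k\<in>{..<n}. U k) \<Longrightarrow> pure_tensor sv n V v \<in> tensor_subspace sv n V U"
  unfolding tensor_subspace_def by (intro tensor.span_base imageI)

lemma tensor_subspace_least:
  assumes "tensor.subspace X" "\<And>v. v \<in> (\<Pi>\<^sub>E k\<in>{..<n}. U k) \<Longrightarrow> pure_tensor sv n V v \<in> X"
  shows "tensor_subspace sv n V U \<subseteq> X"
  unfolding tensor_subspace_def using assms by (intro tensor.span_minimal) auto

lemma tensor_subspace_cong:
  assumes "\<And>k. k < n \<Longrightarrow> U k = U' k"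
  shows "tensor_subspace sv n V U = tensor_subspace sv n V U'"
proof -
  have "(\<Pi>\<^sub>E k\<in>{..<n}. U k) = (\<Pi>\<^sub>E k\<in>{..<n}. U' k)" using assms by (intro PiE_cong) auto
  then show ?thesis by (simp add: tensor_subspace_def)
qed

lemma pure_tensor_add:
  assumes "v \<in> (\<Pi>\<^sub>E k\<in>{..<n}. V k)" "k < n" "a \<in> V k" "b \<in> V k"
  shows "pure_tensor sv n V (v(k := a + b)) =
    pure_tensor sv n V (v(k := a)) + pure_tensor sv n V (v(k := b))"
  using multilinear_pure_tensor[of sv n V] assms unfolding multilinear_on_def linear_on_def by blast

lemma pure_tensor_scale:
  assumes "v \<in> (\<Pi>\<^sub>E k\<in>{..<n}. V k)" "k < n" "a \<in> V k"
  shows "pure_tensor sv n V (v(k := sv c a)) = fun_scale c (pure_tensor sv n V (v(k := a)))"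
  using multilinear_pure_tensor[of sv n V] assms unfolding multilinear_on_def linear_on_def by blast

lemma PiE_fun_upd: "v \<in> (\<Pi>\<^sub>E k\<in>{..<n}. V k) \<Longrightarrow> k < n \<Longrightarrow> a \<in> V k \<Longrightarrow> v(k := a) \<in> (\<Pi>\<^sub>E k\<in>{..<n::nat}. V k)"
  by (auto simp: PiE_iff extensional_def)

text \<open>A pure tensor is evaluation at \<open>v\<close>, so one multilinear form with nonzero
  value at \<open>v\<close> suffices. The product of functionals \<open>l k\<close> with
  \<open>l k (v k) = 1\<close> is such a form; each \<open>l k\<close> comes from extending the
  independent set \<open>{v k}\<close> to a basis.\<close>

lemma pure_tensor_nonzero:
  fixes sv :: "'k::field \<Rightarrow> 'v::ab_group_add \<Rightarrow> 'v"
  assumes sv: "vector_space sv" and v: "\<And>k. k < n \<Longrightarrow> v k \<noteq> 0"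
  shows "pure_tensor sv n V v \<noteq> 0"
proof
  interpret vector_space sv by (rule sv)
  interpret VK: vector_space_pair sv "(*) :: 'k \<Rightarrow> 'k \<Rightarrow> 'k"
    by unfold_locales (simp_all add: algebra_simps)
  define l where "l k = VK.construct {v k} (\<lambda>_. 1)" for k
  have l: "Vector_Spaces.linear sv (*) (l k)" "l k (v k) = 1" if "k < n" for k
  proof -
    have ind: "independent {v k}" using v[OF that] by (simp add: dependent_single)
    show "Vector_Spaces.linear sv (*) (l k)" unfolding l_def by (rule VK.linear_construct[OF ind])
    show "l k (v k) = 1" unfolding l_def by (rule VK.construct_basis[OF ind]) simp
  qed
  define \<phi> where "\<phi> u = (\<Prod>k<n. l k (u k))" for u
  \<comment> \<open>Changing slot \<open>j\<close> affects a single factor, which reduces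
    multilinearity of \<phi> to linearity of \<open>l j\<close>.\<close>
  have "\<phi> (u(j := a)) = l j a * (\<Prod>k\<in>{..<n}-{j}. l k (u k))" if "j < n" for u j a
  proof -
    have "(\<Prod>k\<in>{..<n}-{j}. l k ((u(j := a)) k)) = (\<Prod>k\<in>{..<n}-{j}. l k (u k))"
      by (rule prod.cong) auto
    then show ?thesis
      unfolding \<phi>_def using that prod.remove[of "{..<n}" j "\<lambda>k. l k ((u(j := a)) k)"] by simp
  qed
  note slot = this
  have "multilinear_on sv (*) n V \<phi>"
    unfolding multilinear_on_def linear_on_def
  proof (intro ballI allI impI conjI)
    fix u j assume j: "j < n"
    show "\<phi> (u(j := a + b)) = \<phi> (u(j := a)) + \<phi> (u(j := b))" for a b
      by (simp only: slot[OF j] VK.linear_add[OF l(1)[OF j]] distrib_right)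
    show "\<phi> (u(j := sv c a)) = c * \<phi> (u(j := a))" for a c
      by (simp only: slot[OF j] VK.linear_scale[OF l(1)[OF j]] mult.assoc)
  qed simp
  then have "pure_tensor sv n V v \<phi> = 1" using l(2) by (simp add: pure_tensor_def \<phi>_def)
  moreover assume "pure_tensor sv n V v = 0"
  ultimately show False by simp
qed

lemma tensor_space_spanned_by_pieces:
  assumes sv: "vector_space sv" and sub: "\<And>k. k < n \<Longrightarrow> module.subspace sv (V k)"
    and V: "\<And>k. k < n \<Longrightarrow> V k = module.span sv (\<Union>i\<in>I k. W k i)"
  shows "tensor_space sv n V \<subseteq>
    tensor.span (\<Union>\<mu>\<in>(\<Pi>\<^sub>E k\<in>{..<n}. I k). tensor_subspace sv n V (\<lambda>k. W k (\<mu> k)))"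
proof -
  interpret vector_space sv by (rule sv)
  let ?U = "\<Union>\<mu>\<in>(\<Pi>\<^sub>E k\<in>{..<n}. I k). tensor_subspace sv n V (\<lambda>k. W k (\<mu> k))"
  \<comment> \<open>Arguments in the positions below \<open>j\<close> are arbitrary; induction on \<open>j\<close> frees one more slot.\<close>
  have "pure_tensor sv n V v \<in> tensor.span ?U"
    if "v \<in> (\<Pi>\<^sub>E k\<in>{..<n}. V k)" "\<And>k. j \<le> k \<Longrightarrow> k < n \<Longrightarrow> v k \<in> (\<Union>i\<in>I k. W k i)" for j v
    using that
  proof (induction j arbitrary: v)
    case 0
    have "\<forall>k\<in>{..<n}. \<exists>i. i \<in> I k \<and> v k \<in> W k i" using 0(2) by auto
    from bchoice[OF this] obtain f where f: "\<forall>k\<in>{..<n}. f k \<in> I k \<and> v k \<in> W k (f k)" by blast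
    let ?\<mu> = "restrict f {..<n}"
    have "v \<in> (\<Pi>\<^sub>E k\<in>{..<n}. W k (?\<mu> k))" using f 0(1) by (auto simp: PiE_iff)
    then have "pure_tensor sv n V v \<in> tensor_subspace sv n V (\<lambda>k. W k (?\<mu> k))"
      by (rule pure_tensor_in)
    moreover have "?\<mu> \<in> (\<Pi>\<^sub>E k\<in>{..<n}. I k)" using f by auto
    ultimately show ?case by (intro tensor.span_base) blast
  next
    case (Suc j)
    show ?case
    proof (cases "j < n")
      case False
      with Suc.prems show ?thesis by (intro Suc.IH) auto
    next
      case True
      \<comment> \<open>The arguments that slot \<open>j\<close> tolerates. They form a subspace
        containing all pieces of \<open>V j\<close>, hence all of \<open>V j\<close>.\<close>
      let ?A = "{a \<in> V j. pure_tensor sv n V (v(j := a)) \<in> tensor.span ?U}"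
      have "subspace ?A"
      proof (rule subspaceI)
        have "pure_tensor sv n V (v(j := sv 0 0)) = fun_scale 0 (pure_tensor sv n V (v(j := 0)))"
          by (rule pure_tensor_scale) (use Suc.prems True subspace_0[OF sub] in auto)
        then show "0 \<in> ?A" using subspace_0[OF sub[OF True]] by (simp add: tensor.span_zero)
        show "x + y \<in> ?A" if "x \<in> ?A" "y \<in> ?A" for x y
          using that subspace_add[OF sub[OF True]]
          by (auto simp: pure_tensor_add[OF Suc.prems(1) True] intro: tensor.span_add)
        show "sv c x \<in> ?A" if "x \<in> ?A" for c x
          using that subspace_scale[OF sub[OF True]]
          by (auto simp: pure_tensor_scale[OF Suc.prems(1) True] intro: tensor.span_scale)
      qed
      moreover have "(\<Union>i\<in>I j. W j i) \<subseteq> ?A"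
      proof
        fix a assume a: "a \<in> (\<Union>i\<in>I j. W j i)"
        then have "a \<in> V j" unfolding V[OF True] by (rule span_base)
        moreover have "pure_tensor sv n V (v(j := a)) \<in> tensor.span ?U"
        proof (rule Suc.IH)
          show "v(j := a) \<in> (\<Pi>\<^sub>E k\<in>{..<n}. V k)"
            by (rule PiE_fun_upd[OF Suc.prems(1) True]) fact
          show "(v(j := a)) k \<in> (\<Union>i\<in>I k. W k i)" if "j \<le> k" "k < n" for k
            using a Suc.prems(2)[of k] that by (cases "k = j") auto
        qed
        ultimately show "a \<in> ?A" by simp
      qed
      ultimately have "span (\<Union>i\<in>I j. W j i) \<subseteq> ?A" by (intro span_minimal)
      moreover have "v j \<in> V j" using Suc.prems(1) True by auto
      ultimately have "v j \<in> ?A" using V[OF True] by blast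
      then show ?thesis by simp
    qed
  qed
  \<comment> \<open>At \<open>j = n\<close> the condition on the remaining slots is vacuous.\<close>
  from this[of _ n] show ?thesis
    unfolding tensor_space_def by (intro tensor_subspace_least tensor.subspace_span) auto
qed

section \<open>The representation on the tensor product\<close>

locale graded_lie_bracket = direct_sum s n S
  for s :: "'k::field \<Rightarrow> 'g::ab_group_add \<Rightarrow> 'g" and n S +
  fixes br :: "'g \<Rightarrow> 'g \<Rightarrow> 'g"
  assumes br_left: "Vector_Spaces.linear s s (\<lambda>x. br x y)"
    and br_right: "Vector_Spaces.linear s s (br x)"
    and br_skew: "br x y = - br y x"
    and S_ideal: "k < n \<Longrightarrow> x \<in> S k \<Longrightarrow> br x y \<in> S k"
begin

interpretation VP: vector_space_pair s s ..

text \<open>Distinct summands commute: the bracket of elements of \<open>S i\<close> and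
  \<open>S j\<close> lies in \<open>S i\<close> and, by skewness, in \<open>S j\<close>, which meet
  in 0. The double sum therefore collapses to its diagonal.\<close>

lemma component_br:
  assumes "k < n"
  shows "component n S (br x y) k = br (component n S x k) (component n S y k)"
proof (rule component_eqI[of "\<lambda>k. br (component n S x k) (component n S y k)"])
  let ?x = "component n S x" and ?y = "component n S y"
  have zero: "br (?x i) (?y j) = 0" if "i < n" "j < n" "i \<noteq> j" for i j
  proof (rule S_disjoint[OF that])
    show "br (?x i) (?y j) \<in> S i" using S_ideal component_in that by blast
    have "- br (?y j) (?x i) \<in> S j"
      using S_ideal component_in that subspace_neg[OF subspace_S] by blast
    then show "br (?x i) (?y j) \<in> S j" by (subst br_skew)
  qed
  have "br x y = br (\<Sum>i<n. ?x i) (\<Sum>j<n. ?y j)" by (simp add: sum_component)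
  also have "\<dots> = (\<Sum>i<n. \<Sum>j<n. br (?x i) (?y j))"
    by (simp only: VP.linear_sum[OF br_left]) (simp only: VP.linear_sum[OF br_right])
  also have "\<dots> = (\<Sum>i<n. \<Sum>j<n. if i = j then br (?x i) (?y i) else 0)"
    using zero by (intro sum.cong) auto
  also have "\<dots> = (\<Sum>i<n. br (?x i) (?y i))" by simp
  finally show "(\<Sum>i<n. br (?x i) (?y i)) = br x y" by simp
  show "br (?x j) (?y j) \<in> S j" if "j < n" for j
    using that S_ideal component_in by blast
qed fact

end

text \<open>The total form for arbitrary summands and arbitrary forms on them, with the twist by
  \<alpha> left out; this lets the weights of the tensor product be found without mentioning powers
  of \<alpha>.\<close>

definition sum_form ::
  "nat \<Rightarrow> (nat \<Rightarrow> 'g::ab_group_add set) \<Rightarrow> (nat \<Rightarrow> 'g \<Rightarrow> 'k::comm_monoid_add) \<Rightarrow> 'g \<Rightarrow> 'k" where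
  "sum_form n H \<mu> = restrict (\<lambda>x. \<Sum>k<n. \<mu> k (component n H x k)) (sum_of n H)"

locale tensor_of_reps = graded_lie_bracket s n S br + V: vector_space sv
  for s :: "'k::field \<Rightarrow> 'g::ab_group_add \<Rightarrow> 'g" and n S br
    and sv :: "'k \<Rightarrow> 'v::ab_group_add \<Rightarrow> 'v" +
  fixes V :: "nat \<Rightarrow> 'v set" and \<rho> :: "nat \<Rightarrow> 'g \<Rightarrow> 'v \<Rightarrow> 'v"
  assumes rep: "k < n \<Longrightarrow> lie_rep s br (S k) sv (V k) (\<rho> k)"
begin

abbreviation "T \<equiv> tensor_space sv n V"
abbreviation "pt \<equiv> pure_tensor sv n V"
abbreviation "PV \<equiv> \<Pi>\<^sub>E k\<in>{..<n}. V k"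
abbreviation "\<rho>T \<equiv> tensor_rep sv n V S \<rho>"

text \<open>Through the projection to the k-th summand \<open>V k\<close> becomes a module of the
  whole algebra. The action on \<open>T\<close> is then the usual tensor product action of
  \<open>n\<close> modules over one Lie algebra.\<close>

definition op :: "'g \<Rightarrow> nat \<Rightarrow> 'v \<Rightarrow> 'v" where
  "op x k = \<rho> k (component n S x k)"

lemma subspace_V: "k < n \<Longrightarrow> V.subspace (V k)"
  using rep by (simp add: lie_rep_def)

lemma op_linear: "k < n \<Longrightarrow> linear_on sv sv (V k) (V k) (op x k)"
  using rep[of k] component_in[of k x] by (simp add: lie_rep_def op_def)

lemma op_in: "k < n \<Longrightarrow> v \<in> V k \<Longrightarrow> op x k v \<in> V k"
  using op_linear[of k x] by (auto simp: linear_on_def)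

lemma op_add: "k < n \<Longrightarrow> v \<in> V k \<Longrightarrow> op (x + y) k v = op x k v + op y k v"
  using rep[of k] component_in[of k] by (simp add: lie_rep_def op_def component_add linear_on_def)

lemma op_scale: "k < n \<Longrightarrow> v \<in> V k \<Longrightarrow> op (s c x) k v = sv c (op x k v)"
  using rep[of k] component_in[of k] by (simp add: lie_rep_def op_def component_scale linear_on_def)

lemma op_br: "k < n \<Longrightarrow> v \<in> V k \<Longrightarrow> op (br x y) k v = op x k (op y k v) - op y k (op x k v)"
  using rep[of k] component_in[of k] by (simp add: lie_rep_def op_def component_br)

lemma \<rho>T_sum: "\<rho>T x F = (\<Sum>k<n. tensor_slot sv n V k (op x k) F)"
  by (simp add: tensor_rep_def op_def)

lemma slot_linear:
  "tensor_slot sv n V k f (F + G) = tensor_slot sv n V k f F + tensor_slot sv n V k f G"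
  "tensor_slot sv n V k f (fun_scale c F) = fun_scale c (tensor_slot sv n V k f F)"
  using linear_tensor_slot[of sv n V k f] by (auto simp: linear_on_def)

lemma \<rho>T_add: "\<rho>T x (F + G) = \<rho>T x F + \<rho>T x G"
  by (simp add: \<rho>T_sum slot_linear sum.distrib)

lemma \<rho>T_scale: "\<rho>T x (fun_scale c F) = fun_scale c (\<rho>T x F)"
  by (simp add: \<rho>T_sum slot_linear tensor.scale_sum_right)

lemma \<rho>T_0: "\<rho>T x 0 = 0"
  using \<rho>T_scale[of x 0 0] by simp

lemma slot_pt: "v \<in> PV \<Longrightarrow> k < n \<Longrightarrow> tensor_slot sv n V k (op x k) (pt v) = pt (v(k := op x k (v k)))"
  by (rule tensor_slot_pure_tensor[OF _ op_linear])

lemma upd_PV: "v \<in> PV \<Longrightarrow> k < n \<Longrightarrow> v(k := op x k (v k)) \<in> PV"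
  by (rule PiE_fun_upd) (auto intro!: op_in)

lemma \<rho>T_pt: "v \<in> PV \<Longrightarrow> \<rho>T x (pt v) = (\<Sum>k<n. pt (v(k := op x k (v k))))"
  by (simp add: \<rho>T_sum slot_pt)

lemma tensor_space_subspace: "tensor.subspace T"
  by (simp add: tensor_space_def subspace_tensor_subspace)

text \<open>Reduces an identity that is linear in \<open>F\<close> to pure tensors, because
  \<open>T\<close> is the least subspace containing them.\<close>

lemma tensor_space_induct:
  assumes "F \<in> T" "tensor.subspace {F. Q F}" "\<And>v. v \<in> PV \<Longrightarrow> Q (pt v)"
  shows "Q F"
  using tensor_subspace_least[of "{F. Q F}" n V sv V] assms by (auto simp: tensor_space_def)

lemma \<rho>T_in: "F \<in> T \<Longrightarrow> \<rho>T x F \<in> T"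
proof (erule tensor_space_induct)
  show "tensor.subspace {F. \<rho>T x F \<in> T}"
    using tensor_space_subspace
    by (auto simp: tensor.subspace_def \<rho>T_add \<rho>T_scale \<rho>T_0)
  show "\<rho>T x (pt v) \<in> T" if "v \<in> PV" for v
    unfolding \<rho>T_pt[OF that] tensor_space_def
    using upd_PV[OF that] by (intro tensor.subspace_sum subspace_tensor_subspace pure_tensor_in) auto
qed

lemma \<rho>T_add_left: "F \<in> T \<Longrightarrow> \<rho>T (x + y) F = \<rho>T x F + \<rho>T y F"
proof (erule tensor_space_induct)
  show "tensor.subspace {F. \<rho>T (x + y) F = \<rho>T x F + \<rho>T y F}"
    by (auto simp: tensor.subspace_def \<rho>T_add \<rho>T_scale \<rho>T_0 tensor.scale_right_distrib)
  show "\<rho>T (x + y) (pt v) = \<rho>T x (pt v) + \<rho>T y (pt v)" if v: "v \<in> PV" for v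
  proof -
    have "pt (v(k := op (x + y) k (v k))) = pt (v(k := op x k (v k))) + pt (v(k := op y k (v k)))"
      if k: "k < n" for k
    proof -
      have "v k \<in> V k" using v k by auto
      then show ?thesis using op_in k by (simp add: op_add pure_tensor_add[OF v])
    qed
    then show ?thesis by (simp add: \<rho>T_pt[OF v] sum.distrib)
  qed
qed

lemma \<rho>T_scale_left: "F \<in> T \<Longrightarrow> \<rho>T (s c x) F = fun_scale c (\<rho>T x F)"
proof (erule tensor_space_induct)
  show "tensor.subspace {F. \<rho>T (s c x) F = fun_scale c (\<rho>T x F)}"
    by (auto simp: tensor.subspace_def \<rho>T_add \<rho>T_scale \<rho>T_0 tensor.scale_right_distrib
        tensor.scale_left_commute)
  show "\<rho>T (s c x) (pt v) = fun_scale c (\<rho>T x (pt v))" if v: "v \<in> PV" for v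
  proof -
    have "pt (v(k := op (s c x) k (v k))) = fun_scale c (pt (v(k := op x k (v k))))"
      if k: "k < n" for k
    proof -
      have "v k \<in> V k" using v k by auto
      then show ?thesis using op_in k by (simp add: op_scale pure_tensor_scale[OF v])
    qed
    then show ?thesis by (simp add: \<rho>T_pt[OF v] tensor.scale_sum_right)
  qed
qed

text \<open>Operators in different slots commute, so the mixed terms of the commutator cancel in
  pairs; in equal slots the commutator is that of \<open>\<rho> k\<close>.\<close>

lemma \<rho>T_br: "F \<in> T \<Longrightarrow> \<rho>T (br x y) F = \<rho>T x (\<rho>T y F) - \<rho>T y (\<rho>T x F)"
proof (erule tensor_space_induct)
  show "tensor.subspace {F. \<rho>T (br x y) F = \<rho>T x (\<rho>T y F) - \<rho>T y (\<rho>T x F)}"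
    by (auto simp: tensor.subspace_def \<rho>T_add \<rho>T_scale \<rho>T_0 tensor.scale_right_diff_distrib)
  fix v assume v: "v \<in> PV"
  \<comment> \<open>Slot \<open>k\<close> is altered by \<open>y\<close>, and afterwards slot
    \<open>l\<close> by \<open>x\<close>. The lookup at \<open>l\<close> sees the first alteration,
    so \<open>k = l\<close> gives the composite of both operators.\<close>
  define A where "A x y k l = pt (v(k := op y k (v k), l := op x l ((v(k := op y k (v k))) l)))"
    for x y k l
  have double: "\<rho>T x (\<rho>T y (pt v)) = (\<Sum>k<n. \<Sum>l<n. A x y k l)" for x y
  proof -
    have "\<rho>T x (\<Sum>k\<in>K. G k) = (\<Sum>k\<in>K. \<rho>T x (G k))" for K and G :: "nat \<Rightarrow> _"
      by (induction K rule: infinite_finite_induct) (simp_all only: sum.infinite sum.empty sum.insert \<rho>T_0 \<rho>T_add not_False_eq_True)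
    then show ?thesis
      unfolding \<rho>T_pt[OF v] by (auto simp: \<rho>T_pt[OF upd_PV[OF v]] A_def intro!: sum.cong)
  qed
  have "A x y k l - A y x l k = (if k = l then pt (v(k := op (br x y) k (v k))) else 0)"
    if kl: "k < n" "l < n" for k l
  proof (cases "k = l")
    case True
    have vk: "v k \<in> V k" using v kl by auto
    have "A x y k k = pt (v(k := op (br x y) k (v k) + op y k (op x k (v k))))"
      using kl vk by (simp add: A_def op_br)
    also have "\<dots> = pt (v(k := op (br x y) k (v k))) + A y x k k"
      using kl vk by (simp add: A_def pure_tensor_add[OF v] op_in)
    finally show ?thesis using True by simp
  next
    case False
    then show ?thesis by (simp add: A_def fun_upd_twist)
  qed
  then have "(\<Sum>k<n. \<Sum>l<n. A x y k l - A y x l k) = \<rho>T (br x y) (pt v)"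
    unfolding \<rho>T_pt[OF v] by (intro sum.cong) (auto simp: sum.delta')
  \<comment> \<open>Cancellation pairs the position \<open>(k, l)\<close> of one product with
    \<open>(l, k)\<close> of the other, so one of the double sums has to be transposed.\<close>
  moreover have "(\<Sum>k<n. \<Sum>l<n. A y x l k) = (\<Sum>k<n. \<Sum>l<n. A y x k l)"
    by (rule sum.swap)
  ultimately show "\<rho>T (br x y) (pt v) = \<rho>T x (\<rho>T y (pt v)) - \<rho>T y (\<rho>T x (pt v))"
    by (simp add: double sum_subtractf)
qed

lemma tensor_lie_rep: "lie_rep s br UNIV fun_scale T \<rho>T"
  by (auto simp: lie_rep_def linear_on_def tensor_space_subspace \<rho>T_in \<rho>T_add \<rho>T_scale
      \<rho>T_add_left \<rho>T_scale_left \<rho>T_br)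

section \<open>Weights of the tensor product\<close>

context
  fixes H :: "nat \<Rightarrow> 'g set"
  assumes H: "k < n \<Longrightarrow> subspace (H k)" "k < n \<Longrightarrow> H k \<subseteq> S k"
    and wm: "k < n \<Longrightarrow> weight_module s br (S k) (H k) sv (V k) (\<rho> k)"
begin

abbreviation "P k \<equiv> weights s sv (H k) (V k) (\<rho> k)"
abbreviation "W k \<equiv> weight_space sv (H k) (V k) (\<rho> k)"

abbreviation tform :: "(nat \<Rightarrow> 'g \<Rightarrow> 'k) \<Rightarrow> 'g \<Rightarrow> 'k" where "tform \<equiv> sum_form n H"

lemma sum_form_dual:
  assumes "\<And>k. k < n \<Longrightarrow> \<mu> k \<in> dual_on s (H k)"
  shows "tform \<mu> \<in> dual_on s (sum_of n H)"
proof -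
  have sum_of: "x \<in> sum_of n H \<longleftrightarrow> (\<forall>k<n. component n S x k \<in> H k)" for x
    by (rule sum_of_iff) (rule H)
  have tform: "tform \<mu> x = (\<Sum>k<n. \<mu> k (component n S x k))" if "x \<in> sum_of n H" for x
    using that component_subfamily(1)[OF H(2) that] by (simp add: sum_form_def)
  have add: "x + y \<in> sum_of n H" if "x \<in> sum_of n H" "y \<in> sum_of n H" for x y
    using that by (auto simp: sum_of component_add intro: subspace_add[OF H(1)])
  have scale: "s c x \<in> sum_of n H" if "x \<in> sum_of n H" for c x
    using that by (auto simp: sum_of component_scale intro: subspace_scale[OF H(1)])
  have \<mu>: "\<mu> k (a + b) = \<mu> k a + \<mu> k b" "\<mu> k (s c a) = c * \<mu> k a"
    if "k < n" "a \<in> H k" "b \<in> H k" for k a b c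
    using assms[OF that(1)] that by (auto simp: dual_on_def linear_on_def)
  have "tform \<mu> (x + y) = tform \<mu> x + tform \<mu> y"
    if x: "x \<in> sum_of n H" and y: "y \<in> sum_of n H" for x y
    unfolding tform[OF x] tform[OF y] tform[OF add[OF x y]] sum.distrib[symmetric]
    using x y by (intro sum.cong) (auto simp: sum_of component_add \<mu>)
  moreover have "tform \<mu> (s c x) = c * tform \<mu> x" if x: "x \<in> sum_of n H" for x c
    unfolding tform[OF x] tform[OF scale[OF x]] sum_distrib_left
    using x by (intro sum.cong) (auto simp: sum_of component_scale \<mu>)
  ultimately show ?thesis
    by (auto simp: dual_on_def linear_on_def) (simp add: sum_form_def)
qed

text \<open>All components of \<open>x\<close> except the k-th are 0, and linear forms vanish there.
  Each form of a tuple can thus be read off from the total form.\<close>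

lemma sum_form_on_summand:
  assumes \<mu>: "\<And>k. k < n \<Longrightarrow> \<mu> k \<in> dual_on s (H k)" and k: "k < n" and x: "x \<in> H k"
  shows "tform \<mu> x = \<mu> k x"
proof -
  have comp: "component n S x j = (if j = k then x else 0)" if "j < n" for j
    using component_single[OF k _ that] x H(2)[OF k] by blast
  have sum_of: "x \<in> sum_of n H"
    using sum_of_iff[of H x] H comp x subspace_0 by auto
  have \<mu>0: "\<mu> j 0 = 0" if "j < n" for j
  proof -
    have "\<mu> j (s 0 0) = 0 * \<mu> j 0"
      using \<mu>[OF that] subspace_0[OF H(1)[OF that]] unfolding dual_on_def linear_on_def by blast
    then show ?thesis by simp
  qed
  have "tform \<mu> x = (\<Sum>j<n. \<mu> j (component n S x j))"
    using sum_of component_subfamily(1)[OF H(2) sum_of] by (simp add: sum_form_def)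
  also have "\<dots> = (\<Sum>j<n. if j = k then \<mu> k x else 0)"
    using comp \<mu>0 by (intro sum.cong) auto
  finally show ?thesis using k by simp
qed

text \<open>Ensures that a weight determines its tuple, so that each weight space is a single
  product of weight spaces.\<close>

lemma inj_on_sum_form: "inj_on tform (\<Pi>\<^sub>E k\<in>{..<n}. dual_on s (H k))"
proof (rule inj_onI)
  fix \<mu> \<nu>
  assume \<mu>: "\<mu> \<in> (\<Pi>\<^sub>E k\<in>{..<n}. dual_on s (H k))" and \<nu>: "\<nu> \<in> (\<Pi>\<^sub>E k\<in>{..<n}. dual_on s (H k))"
    and eq: "tform \<mu> = tform \<nu>"
  show "\<mu> = \<nu>"
  proof (rule PiE_ext[OF \<mu> \<nu>])
    fix k assume k: "k \<in> {..<n}"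
    have "\<mu> k x = \<nu> k x" if x: "x \<in> H k" for x
      using sum_form_on_summand[OF _ _ x, of \<mu>] sum_form_on_summand[OF _ _ x, of \<nu>] \<mu> \<nu> k eq
      by (auto simp: PiE_iff)
    moreover have "\<mu> k \<in> extensional (H k)" "\<nu> k \<in> extensional (H k)"
      using \<mu> \<nu> k by (auto simp: dual_on_def PiE_iff)
    ultimately show "\<mu> k = \<nu> k" by (intro extensionalityI)
  qed
qed

text \<open>On a pure tensor of weight vectors, slot \<open>k\<close> contributes the scalar
  \<open>\<mu> k\<close> at the k-th component of \<open>x\<close>, and the sum over the slots adds
  these scalars.\<close>

lemma tensor_weight_space:
  "tensor_subspace sv n V (\<lambda>k. W k (\<mu> k)) \<subseteq> weight_space fun_scale (sum_of n H) T \<rho>T (tform \<mu>)"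
proof (rule tensor_subspace_least)
  interpret R: operator_family fun_scale "sum_of n H" T \<rho>T
    using tensor_lie_rep by unfold_locales (auto simp: lie_rep_def)
  show "tensor.subspace (weight_space fun_scale (sum_of n H) T \<rho>T (tform \<mu>))"
    by (rule R.subspace_weight_space)
  fix v assume v: "v \<in> (\<Pi>\<^sub>E k\<in>{..<n}. W k (\<mu> k))"
  then have PV: "v \<in> PV" by (auto simp: PiE_iff weight_space_def)
  have "\<rho>T x (pt v) = fun_scale (tform \<mu> x) (pt v)" if x: "x \<in> sum_of n H" for x
  proof -
    note sub = component_subfamily[OF H(2) x]
    have "pt (v(k := op x k (v k))) = fun_scale (\<mu> k (component n S x k)) (pt v)" if k: "k < n" for k
    proof -
      have "op x k (v k) = sv (\<mu> k (component n S x k)) (v k)"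
        using v sub(2)[OF _ k] k by (auto simp: op_def weight_space_def PiE_iff)
      then show ?thesis
        using pure_tensor_scale[OF PV k, of "v k"] PV k by auto
    qed
    then show ?thesis
      using x sub(1) by (simp add: \<rho>T_pt[OF PV] sum_form_def tensor.scale_sum_left)
  qed
  then show "pt v \<in> weight_space fun_scale (sum_of n H) T \<rho>T (tform \<mu>)"
    using pure_tensor_in[OF PV] by (auto simp: weight_space_def tensor_space_def)
qed

lemma tensor_weight_decomposition:
  defines "tuples \<equiv> \<Pi>\<^sub>E k\<in>{..<n}. P k"
    and "h \<equiv> sum_of n H"
    and "piece \<equiv> \<lambda>\<mu>. tensor_subspace sv n V (\<lambda>k. W k (\<mu> k))"
  shows "weights s fun_scale h T \<rho>T = tform ` tuples"
    and "inj_on tform tuples"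
    and "weight_module s br UNIV h fun_scale T \<rho>T"
    and "\<And>\<mu>. \<mu> \<in> tuples \<Longrightarrow> weight_space fun_scale h T \<rho>T (tform \<mu>) = piece \<mu>"
proof -
  interpret R: operator_family fun_scale h T \<rho>T
    using tensor_lie_rep by unfold_locales (auto simp: lie_rep_def)
  have dual: "\<mu> k \<in> dual_on s (H k)" if "\<mu> \<in> tuples" "k < n" for \<mu> k
    using that by (auto simp: tuples_def PiE_iff weights_def)
  have "tuples \<subseteq> (\<Pi>\<^sub>E k\<in>{..<n}. dual_on s (H k))"
    unfolding tuples_def weights_def by (intro PiE_mono) auto
  then show inj: "inj_on tform tuples" using inj_on_sum_form inj_on_subset by blast
  \<comment> \<open>Pieces must be indexed by forms; \<open>w\<close> recovers the tuple from its
    form.\<close>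
  define w where "w = the_inv_into tuples tform"
  have w: "w (tform \<mu>) = \<mu>" if "\<mu> \<in> tuples" for \<mu>
    unfolding w_def by (rule the_inv_into_f_f[OF inj that])
  have I: "tform ` tuples \<subseteq> dual_on s h"
    unfolding h_def using sum_form_dual dual by blast
  have sub: "tensor.subspace (piece (w \<nu>))" for \<nu>
    by (simp add: piece_def subspace_tensor_subspace)
  have le: "piece (w \<nu>) \<subseteq> R.ws \<nu>" if "\<nu> \<in> tform ` tuples" for \<nu>
  proof -
    from that obtain \<mu> where "\<mu> \<in> tuples" "\<nu> = tform \<mu>" by blast
    then show ?thesis using tensor_weight_space[of \<mu>] w by (simp add: piece_def h_def)
  qed
  have nz: "piece (w \<nu>) \<noteq> {0}" if "\<nu> \<in> tform ` tuples" for \<nu>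
  proof -
    from that obtain \<mu> where \<mu>: "\<mu> \<in> tuples" "\<nu> = tform \<mu>" by blast
    have "\<exists>v. v \<in> W k (\<mu> k) \<and> v \<noteq> 0" if k: "k \<in> {..<n}" for k
    proof -
      interpret K: operator_family sv "H k" "V k" "\<rho> k"
        using rep[of k] H(2)[of k] k by unfold_locales (auto simp: lie_rep_def)
      have "W k (\<mu> k) \<noteq> {0}" using \<mu>(1) k by (auto simp: tuples_def PiE_iff weights_def)
      then show ?thesis using V.subspace_0[OF K.subspace_weight_space] by blast
    qed
    then have "\<forall>k\<in>{..<n}. \<exists>v. v \<in> W k (\<mu> k) \<and> v \<noteq> 0" by blast
    from bchoice[OF this] obtain f where f: "\<forall>k\<in>{..<n}. f k \<in> W k (\<mu> k) \<and> f k \<noteq> 0" by blast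
    let ?v = "restrict f {..<n}"
    have "pt ?v \<in> piece \<mu>" unfolding piece_def using f by (intro pure_tensor_in) auto
    moreover have "pt ?v \<noteq> 0"
      by (rule pure_tensor_nonzero[OF V.vector_space_axioms]) (use f in auto)
    ultimately show ?thesis using w[OF \<mu>(1)] \<mu>(2) by auto
  qed
  have "T \<subseteq> tensor.span (\<Union>\<mu>\<in>tuples. piece \<mu>)"
    unfolding tuples_def piece_def
    using wm subspace_V
    by (intro tensor_space_spanned_by_pieces[OF V.vector_space_axioms])
      (auto simp: weight_module_def internal_direct_sum_def)
  also have "(\<Union>\<mu>\<in>tuples. piece \<mu>) = (\<Union>\<nu>\<in>tform ` tuples. piece (w \<nu>))"
    using w by simp
  finally have span: "T \<subseteq> tensor.span (\<Union>\<nu>\<in>tform ` tuples. piece (w \<nu>))" .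
  note dec = R.weight_space_decomposition[OF I sub le nz span]
  show weights: "weights s fun_scale h T \<rho>T = tform ` tuples" by (rule dec(1))
  show "weight_module s br UNIV h fun_scale T \<rho>T"
    using dec(3) tensor_lie_rep weights by (simp add: weight_module_def)
  show "R.ws (tform \<mu>) = piece \<mu>" if "\<mu> \<in> tuples" for \<mu>
    using dec(2)[of "tform \<mu>"] w[OF that] that by simp
qed

end

end

section \<open>Specialisation to the summands given by powers of \<alpha>\<close>

lemma total_form_eq_sum_form:
  "total_form \<alpha> H n \<mu> =
    sum_form n (\<lambda>k. (\<alpha> ^^ k) ` H) (\<lambda>k\<in>{..<n}. twisted_form \<alpha> H k (\<mu> k))"
  unfolding total_form_def sum_form_def
  by (intro restrict_ext sum.cong) (auto simp: extend_form_def)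

text \<open>Existence of the twisted representations is separated from their consequences, which are
  claimed for every compatible choice. The injectivity clause gives meaning to the indexing of the
  direct sum, where each weight is turned back into the tuple it comes from.\<close>

theorem proposition5p3:
  fixes sg :: "'k::{alg_closed_field, field_char_0} \<Rightarrow> 'g::ab_group_add \<Rightarrow> 'g"
    and brk :: "'g \<Rightarrow> 'g \<Rightarrow> 'g" and \<alpha> :: "'g \<Rightarrow> 'g"
    and g1 h1 :: "'g set" and n :: nat
    and sv :: "'k \<Rightarrow> 'v::ab_group_add \<Rightarrow> 'v"
    and V :: "nat \<Rightarrow> 'v set" and \<rho> :: "nat \<Rightarrow> 'g \<Rightarrow> 'v \<Rightarrow> 'v"
  defines "br \<equiv> induced_bracket brk \<alpha>"
    and "gk \<equiv> \<lambda>k. (\<alpha> ^^ k) ` g1"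
    and "hk \<equiv> \<lambda>k. (\<alpha> ^^ k) ` h1"
    and "h \<equiv> sum_of n (\<lambda>k. (\<alpha> ^^ k) ` h1)"
    and "P \<equiv> \<lambda>k. weights sg sv h1 (V k) (\<rho> k)"
    and "T \<equiv> tensor_space sv n V"
  assumes hom_lie: "simple_multiplicative_hom_lie_algebra sg brk \<alpha>"
    and g1_ideal: "lie_ideal sg br UNIV g1"
    and g1_simple: "simple_lie sg br g1"
    and n_pos: "n \<ge> 1"
    and decomposition: "internal_direct_sum sg UNIV {..<n} gk"
    and g1_period: "(\<alpha> ^^ n) ` g1 = g1"
    and cartan: "cartan_subalgebra sg br g1 h1"
    and ambient: "vector_space sv"
    and V_weight: "\<And>k. k < n \<Longrightarrow> weight_module sg br g1 h1 sv (V k) (\<rho> k)"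
  shows
    "(\<forall>k<n. \<exists>\<rho>' \<beta>. lie_rep sg br (gk k) sv (V k) \<rho>' \<and> \<beta> \<in> GL_on sv (V k) \<and>
        twist_compatible \<alpha> k g1 (V k) (\<rho> k) \<rho>' \<beta>) \<and>
     (\<forall>\<rho>' \<beta>.
        (\<forall>k<n. lie_rep sg br (gk k) sv (V k) (\<rho>' k) \<and> \<beta> k \<in> GL_on sv (V k) \<and>
           twist_compatible \<alpha> k g1 (V k) (\<rho> k) (\<rho>' k) (\<beta> k)) \<longrightarrow>
        (let \<rho>T = tensor_rep sv n V gk \<rho>';
             PT = weights sg fun_scale h T \<rho>T;
             tuples = (\<Pi>\<^sub>E k\<in>{..<n}. P k);
             piece = (\<lambda>\<mu>s. tensor_subspace sv n V
                 (\<lambda>k. weight_space sv (hk k) (V k) (\<rho>' k) (twisted_form \<alpha> h1 k (\<mu>s k))))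
         in
          (\<forall>k<n. weight_module sg br (gk k) (hk k) sv (V k) (\<rho>' k) \<and>
             (\<forall>\<mu>\<in>P k.
                twisted_form \<alpha> h1 k \<mu> \<in> weights sg sv (hk k) (V k) (\<rho>' k) \<and>
                (\<beta> k ^^ k) ` weight_space sv h1 (V k) (\<rho> k) \<mu> =
                  weight_space sv (hk k) (V k) (\<rho>' k) (twisted_form \<alpha> h1 k \<mu>))) \<and>
          PT = total_form \<alpha> h1 n ` tuples \<and>
          inj_on (total_form \<alpha> h1 n) tuples \<and>
          weight_module sg br UNIV h fun_scale T \<rho>T \<and>
          (\<forall>\<mu>s\<in>tuples. weight_space fun_scale h T \<rho>T (total_form \<alpha> h1 n \<mu>s) = piece \<mu>s) \<and>
          internal_direct_sum fun_scale T PT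
            (\<lambda>\<mu>. piece (the_inv_into tuples (total_form \<alpha> h1 n) \<mu>))))"
proof -
  interpret G: simple_multiplicative_hom_lie_algebra sg brk \<alpha> by (rule hom_lie)
  interpret D: direct_sum sg n gk by unfold_locales (rule decomposition)
  have bij: "bij \<alpha>"
  proof (rule G.bij_twist)
    show "internal_direct_sum sg UNIV {..<n} (\<lambda>k. (\<alpha> ^^ k) ` g1)"
      using decomposition by (simp add: gk_def)
    show "(UNIV :: 'g set) \<noteq> {0}"
      using g1_simple unfolding simple_lie_def by (metis UNIV_I singletonD)
  qed (rule g1_period)
  note lin = G.linear_twist
  note br_twist = G.twist_induced_bracket[OF bij, folded br_def]
  have gk_eq: "(\<alpha> ^^ k) ` g1 = gk k" and hk_eq: "(\<alpha> ^^ k) ` h1 = hk k" for k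
    by (simp_all add: gk_def hk_def)
  have pow_surj: "\<exists>z. y = (\<alpha> ^^ k) z" for k y
    using bij_betw_funpow[OF bij, of k] by (metis bij_pointE)
  \<comment> \<open>Any \<open>y\<close> is a value of \<open>\<alpha> ^^ k\<close>, so the ideal
    property of \<open>g1\<close> against the whole algebra is carried over by the
    automorphism.\<close>
  have gk_ideal: "br x y \<in> gk k" if "x \<in> gk k" for x y k
  proof -
    from that obtain u where u: "u \<in> g1" "x = (\<alpha> ^^ k) u" by (auto simp: gk_def)
    obtain z where z: "y = (\<alpha> ^^ k) z" using pow_surj by blast
    have "br x y = (\<alpha> ^^ k) (br u z)" by (simp only: br_twist u(2) z)
    moreover have "br u z \<in> g1" using g1_ideal u(1) by (simp add: lie_ideal_def)
    ultimately show ?thesis by (simp add: gk_def)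
  qed
  have h1: "module.subspace sg h1" "h1 \<subseteq> g1"
    using cartan by (auto simp: cartan_subalgebra_def)
  have rep_\<rho>: "lie_rep sg br g1 sv (V k) (\<rho> k)" if "k < n" for k
    using V_weight[OF that] by (simp add: weight_module_def)
  show ?thesis
  proof (intro conjI allI impI)
    fix k assume "k < n"
    show "\<exists>\<rho>' \<beta>. lie_rep sg br (gk k) sv (V k) \<rho>' \<and> \<beta> \<in> GL_on sv (V k) \<and>
        twist_compatible \<alpha> k g1 (V k) (\<rho> k) \<rho>' \<beta>"
      using twisted_rep_exists[OF bij lin rep_\<rho>[OF \<open>k < n\<close>] br_twist] unfolding gk_eq .
  next
    fix \<rho>' \<beta>
    assume "\<forall>k<n. lie_rep sg br (gk k) sv (V k) (\<rho>' k) \<and> \<beta> k \<in> GL_on sv (V k) \<and>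
      twist_compatible \<alpha> k g1 (V k) (\<rho> k) (\<rho>' k) (\<beta> k)"
    then have rep: "lie_rep sg br (gk k) sv (V k) (\<rho>' k)" and \<beta>: "\<beta> k \<in> GL_on sv (V k)"
      and comp: "twist_compatible \<alpha> k g1 (V k) (\<rho> k) (\<rho>' k) (\<beta> k)" if "k < n" for k
      using that by blast+
    note twist = weight_module_twist[OF bij lin ambient V_weight h1 rep[unfolded gk_def] \<beta> comp,
        unfolded gk_eq hk_eq]
    interpret TR: tensor_of_reps sg n gk br sv V \<rho>'
      by (intro tensor_of_reps.intro graded_lie_bracket.intro graded_lie_bracket_axioms.intro
          tensor_of_reps_axioms.intro D.direct_sum_axioms ambient)
        (rule G.induced_bracket_linear_left[OF bij, folded br_def]
          G.induced_bracket_linear_right[OF bij, folded br_def]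
          G.induced_bracket_skew[OF bij, folded br_def] gk_ideal rep; assumption)+
    have hk: "module.subspace sg (hk k)" "hk k \<subseteq> gk k" for k
    proof -
      show "hk k \<subseteq> gk k" using h1(2) by (auto simp: hk_def gk_def)
      interpret VP: vector_space_pair sg sg ..
      show "module.subspace sg (hk k)"
        unfolding hk_def by (rule VP.linear_subspace_image[OF linear_funpow[OF lin] h1(1)])
    qed
    let ?W = "\<lambda>k. weight_space sv (hk k) (V k) (\<rho>' k)"
    let ?T' = "\<Pi>\<^sub>E k\<in>{..<n}. weights sg sv (hk k) (V k) (\<rho>' k)"
    let ?tuples = "\<Pi>\<^sub>E k\<in>{..<n}. P k"
    \<comment> \<open>Twists a tuple slot by slot, cut off at \<open>n\<close> to land in the
      extensional product. It is a bijection onto the tuples of weights of the twisted modules, and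
      \<open>total_form\<close> is \<open>sum_form\<close> after it.\<close>
    let ?\<tau> = "\<lambda>\<mu>s. \<lambda>k\<in>{..<n}. twisted_form \<alpha> h1 k (\<mu>s k)"
    let ?\<rho>T = "tensor_rep sv n V gk \<rho>'"
    let ?PT = "weights sg fun_scale h T ?\<rho>T"
    let ?piece = "\<lambda>\<mu>s. tensor_subspace sv n V (\<lambda>k. ?W k (twisted_form \<alpha> h1 k (\<mu>s k)))"
    have P': "weights sg sv (hk k) (V k) (\<rho>' k) = twisted_form \<alpha> h1 k ` P k" if "k < n" for k
      unfolding P_def by (rule twist(2)[OF that that that that])
    have total: "total_form \<alpha> h1 n \<mu>s = sum_form n hk (?\<tau> \<mu>s)" for \<mu>s
      unfolding hk_def by (rule total_form_eq_sum_form)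
    have \<tau>_image: "?\<tau> ` ?tuples = ?T'"
    proof (intro subset_antisym subsetI)
      fix \<nu> assume \<nu>: "\<nu> \<in> ?T'"
      then have "\<forall>k\<in>{..<n}. \<exists>\<mu>. \<mu> \<in> P k \<and> \<nu> k = twisted_form \<alpha> h1 k \<mu>"
        using P' by (fastforce simp: PiE_iff)
      from bchoice[OF this] obtain f where
        f: "\<forall>k\<in>{..<n}. f k \<in> P k \<and> \<nu> k = twisted_form \<alpha> h1 k (f k)" by blast
      then have "\<nu> = ?\<tau> (restrict f {..<n})" 
        by (intro PiE_ext[OF \<nu>]) (use \<nu> in \<open>auto simp: PiE_iff\<close>)
      moreover have "restrict f {..<n} \<in> ?tuples" using f by auto
      ultimately show "\<nu> \<in> ?\<tau> ` ?tuples" by (rule image_eqI)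
    qed (use P' in \<open>auto simp: PiE_iff\<close>)
    have \<tau>_inj: "inj_on ?\<tau> ?tuples"
    proof (rule inj_onI)
      fix \<mu> \<nu> assume \<mu>: "\<mu> \<in> ?tuples" and \<nu>: "\<nu> \<in> ?tuples" and eq: "?\<tau> \<mu> = ?\<tau> \<nu>"
      show "\<mu> = \<nu>"
      proof (rule PiE_ext[OF \<mu> \<nu>])
        fix k assume k: "k \<in> {..<n}"
        then have "twisted_form \<alpha> h1 k (\<mu> k) = twisted_form \<alpha> h1 k (\<nu> k)"
          using fun_cong[OF eq, of k] by simp
        moreover have "\<mu> k \<in> extensional h1" "\<nu> k \<in> extensional h1"
          using \<mu> \<nu> k by (auto simp: PiE_iff P_def weights_def dual_on_def)
        ultimately show "\<mu> k = \<nu> k" by (rule inj_onD[OF inj_on_twisted_form[OF bij]])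
      qed
    qed
    have h_eq: "h = sum_of n hk" by (simp add: h_def hk_def)
    have wm_k: "weight_module sg br (gk k) (hk k) sv (V k) (\<rho>' k)" if "k < n" for k
      by (rule twist(1)[OF that that that that])
    have dec: "?PT = sum_form n hk ` ?T'" "inj_on (sum_form n hk) ?T'"
      "weight_module sg br UNIV h fun_scale T ?\<rho>T"
      "\<And>\<mu>. \<mu> \<in> ?T' \<Longrightarrow> weight_space fun_scale h T ?\<rho>T (sum_form n hk \<mu>) =
        tensor_subspace sv n V (\<lambda>k. ?W k (\<mu> k))"
      by (rule TR.tensor_weight_decomposition[of hk, OF hk wm_k, folded h_eq T_def]; assumption)+
    have PT: "?PT = total_form \<alpha> h1 n ` ?tuples"
      using dec(1) unfolding \<tau>_image[symmetric] total by (simp only: image_image)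
    have inj: "inj_on (total_form \<alpha> h1 n) ?tuples"
      using comp_inj_on[OF \<tau>_inj, of "sum_form n hk"] dec(2) unfolding \<tau>_image total comp_def by blast
    have piece: "weight_space fun_scale h T ?\<rho>T (total_form \<alpha> h1 n \<mu>s) = ?piece \<mu>s"
      if "\<mu>s \<in> ?tuples" for \<mu>s
    proof -
      have "?\<tau> \<mu>s \<in> ?T'" using \<tau>_image that by blast
      from dec(4)[OF this] have "weight_space fun_scale h T ?\<rho>T (total_form \<alpha> h1 n \<mu>s) =
          tensor_subspace sv n V (\<lambda>k. ?W k (?\<tau> \<mu>s k))"
        unfolding total .
      \<comment> \<open>The cut-off changes only slots from \<open>n\<close> on, which the tensor
        subspace does not see.\<close>
      also have "\<dots> = ?piece \<mu>s" by (rule tensor_subspace_cong) simp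
      finally show ?thesis .
    qed
    have direct: "internal_direct_sum fun_scale T ?PT
        (\<lambda>\<mu>. ?piece (the_inv_into ?tuples (total_form \<alpha> h1 n) \<mu>))"
    proof (rule iffD1[OF internal_direct_sum_cong])
      show "internal_direct_sum fun_scale T ?PT (weight_space fun_scale h T ?\<rho>T)"
        using dec(3) by (simp add: weight_module_def)
      fix \<mu> assume "\<mu> \<in> ?PT"
      then obtain \<mu>s where \<mu>s: "\<mu>s \<in> ?tuples" "\<mu> = total_form \<alpha> h1 n \<mu>s" unfolding PT by blast
      then show "weight_space fun_scale h T ?\<rho>T \<mu> =
          ?piece (the_inv_into ?tuples (total_form \<alpha> h1 n) \<mu>)"
        using piece[OF \<mu>s(1)] the_inv_into_f_f[OF inj \<mu>s(1)] by simp
    qed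
    have "weight_module sg br (gk k) (hk k) sv (V k) (\<rho>' k) \<and>
        (\<forall>\<mu>\<in>P k. twisted_form \<alpha> h1 k \<mu> \<in> weights sg sv (hk k) (V k) (\<rho>' k) \<and>
          (\<beta> k ^^ k) ` weight_space sv h1 (V k) (\<rho> k) \<mu> = ?W k (twisted_form \<alpha> h1 k \<mu>))"
      if "k < n" for k
      using wm_k[OF that] twist(3)[OF that that that that] P'[OF that] by blast
    then have modules: "\<forall>k<n. weight_module sg br (gk k) (hk k) sv (V k) (\<rho>' k) \<and>
        (\<forall>\<mu>\<in>P k. twisted_form \<alpha> h1 k \<mu> \<in> weights sg sv (hk k) (V k) (\<rho>' k) \<and>
          (\<beta> k ^^ k) ` weight_space sv h1 (V k) (\<rho> k) \<mu> = ?W k (twisted_form \<alpha> h1 k \<mu>))"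
      by simp
    show "let \<rho>T = tensor_rep sv n V gk \<rho>';
             PT = weights sg fun_scale h T \<rho>T;
             tuples = (\<Pi>\<^sub>E k\<in>{..<n}. P k);
             piece = (\<lambda>\<mu>s. tensor_subspace sv n V
                 (\<lambda>k. weight_space sv (hk k) (V k) (\<rho>' k) (twisted_form \<alpha> h1 k (\<mu>s k))))
         in
          (\<forall>k<n. weight_module sg br (gk k) (hk k) sv (V k) (\<rho>' k) \<and>
             (\<forall>\<mu>\<in>P k.
                twisted_form \<alpha> h1 k \<mu> \<in> weights sg sv (hk k) (V k) (\<rho>' k) \<and>
                (\<beta> k ^^ k) ` weight_space sv h1 (V k) (\<rho> k) \<mu> =
                  weight_space sv (hk k) (V k) (\<rho>' k) (twisted_form \<alpha> h1 k \<mu>))) \<and>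
          PT = total_form \<alpha> h1 n ` tuples \<and>
          inj_on (total_form \<alpha> h1 n) tuples \<and>
          weight_module sg br UNIV h fun_scale T \<rho>T \<and>
          (\<forall>\<mu>s\<in>tuples. weight_space fun_scale h T \<rho>T (total_form \<alpha> h1 n \<mu>s) = piece \<mu>s) \<and>
          internal_direct_sum fun_scale T PT
            (\<lambda>\<mu>. piece (the_inv_into tuples (total_form \<alpha> h1 n) \<mu>))"
      unfolding Let_def by (intro conjI ballI modules PT inj dec(3) piece direct)
  qed
qed

end
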